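(* $$0 \leq \delta(\overline{\Sigma}) \leq 1/16.$$
   Context: For a positive integer $n$, $\sigma(n)=\sum_{d\mid n} d$ is the sum of its positive divisors. Let $\Sigma$ be the set consisting of $0$ and all positive integers $n$ with $\sigma(n)$ odd. For a set $F$ of nonnegative integers, $F(q)=\sum_{f\in F} q^f \in \mathbb{F}_2[[q]]$. If $0\in F$, the reciprocal $\overline{F}$ is the unique set of nonnegative integers with $F(q)\,\overline{F}(q)=1$ in $\mathbb{F}_2[[q]]$; thus $\overline{\Sigma}$ is the set of exponents with nonzero coefficient in $1/\Sigma(q)\in\mathbb{F}_2[[q]]$. The relative density of $\overline{\Sigma}$ is $\delta(\overline{\Sigma},n)=\frac{|\overline{\Sigma}\cap[0,n]|}{n+1}$, and its natural density is $\delta(\overline{\Sigma})=\lim_{n\to\infty}\delta(\overline{\Sigma},n)$. *)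

theory Defs
  imports
    Complex_Main
    "HOL-Library.Z2"
    "HOL-Library.Extended_Real"
    "HOL-Computational_Algebra.Formal_Power_Series"
begin

definition divisor_sum :: "nat \<Rightarrow> nat" where
  "divisor_sum n = (\<Sum>d | d dvd n. d)"

definition odd_sigma_set :: "nat set" where
  "odd_sigma_set = {0} \<union> {n. n > 0 \<and> odd (divisor_sum n)}"

text \<open>The type \<open>bit\<close> is the field with two elements.\<close>

definition gen_fps :: "nat set \<Rightarrow> bit fps" where
  "gen_fps F = Abs_fps (\<lambda>n. of_bool (n \<in> F))"

definition reciprocal_set :: "nat set \<Rightarrow> nat set" where
  "reciprocal_set F = (THE G. gen_fps F * gen_fps G = 1)"

definition rel_density :: "nat set \<Rightarrow> nat \<Rightarrow> real" where
  "rel_density A n = real (card (A \<inter> {0..n})) / (real n + 1)"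

text \<open>
  The value of \<open>natural_density\<close> is meaningful only if \<open>convergent (rel_density A)\<close>;
  the lower and upper densities always make sense.
\<close>

definition natural_density :: "nat set \<Rightarrow> real" where
  "natural_density A = lim (rel_density A)"

definition lower_density :: "nat set \<Rightarrow> ereal" where
  "lower_density A = liminf (\<lambda>n. ereal (rel_density A n))"

definition upper_density :: "nat set \<Rightarrow> ereal" where
  "upper_density A = limsup (\<lambda>n. ereal (rel_density A n))"

text \<open>
  The definite description in \<open>reciprocal_set\<close> denotes whenever \<open>0 \<in> F\<close>, and it is then the
  set of exponents with nonzero coefficient in the inverse power series.
\<close>

lemma gen_fps_nth [simp]: "fps_nth (gen_fps F) n = of_bool (n \<in> F)"
  by (simp add: gen_fps_def)

lemma gen_fps_support: "gen_fps {n. fps_nth f n \<noteq> 0} = f"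
proof (rule fps_ext)
  fix n
  show "fps_nth (gen_fps {n. fps_nth f n \<noteq> 0}) n = fps_nth f n"
    by (cases "fps_nth f n") auto
qed

lemma inj_gen_fps: "gen_fps F = gen_fps G \<longleftrightarrow> F = G"
proof
  assume "gen_fps F = gen_fps G"
  then have "(of_bool (n \<in> F) :: bit) = of_bool (n \<in> G)" for n
    by (metis gen_fps_nth)
  then have "n \<in> F \<longleftrightarrow> n \<in> G" for n
    by (metis of_bool_eq_iff)
  then show "F = G"
    by blast
qed simp

lemma gen_fps_mult_eq_1_iff:
  assumes "0 \<in> F"
  shows "gen_fps F * gen_fps G = 1 \<longleftrightarrow> G = {n. fps_nth (inverse (gen_fps F)) n \<noteq> 0}"
proof -
  have inv: "inverse (gen_fps F) * gen_fps F = 1"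
    using assms by (intro inverse_mult_eq_1) simp
  have "gen_fps F * gen_fps G = 1 \<longleftrightarrow> gen_fps G = inverse (gen_fps F)"
  proof
    assume "gen_fps F * gen_fps G = 1"
    then have "inverse (gen_fps F) * gen_fps F * gen_fps G = inverse (gen_fps F)"
      by (simp add: mult.assoc)
    then show "gen_fps G = inverse (gen_fps F)"
      by (simp add: inv)
  next
    assume "gen_fps G = inverse (gen_fps F)"
    then show "gen_fps F * gen_fps G = 1"
      using inv by (simp add: mult.commute)
  qed
  also have "\<dots> \<longleftrightarrow> G = {n. fps_nth (inverse (gen_fps F)) n \<noteq> 0}"
    by (subst gen_fps_support [of "inverse (gen_fps F)", symmetric]) (rule inj_gen_fps)
  finally show ?thesis .
qed

lemma reciprocal_set_eq:
  assumes "0 \<in> F"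
  shows "reciprocal_set F = {n. fps_nth (inverse (gen_fps F)) n \<noteq> 0}"
  unfolding reciprocal_set_def gen_fps_mult_eq_1_iff [OF assms] by simp

lemma gen_fps_reciprocal_set:
  assumes "0 \<in> F"
  shows "gen_fps F * gen_fps (reciprocal_set F) = 1"
  using gen_fps_mult_eq_1_iff [OF assms] reciprocal_set_eq [OF assms] by simp

end

theory Submission
  imports
    Defs
    "HOL-Library.Discrete_Functions"
    "HOL-Library.Disjoint_Sets"
    "HOL-Computational_Algebra.Squarefree"
    "HOL-Number_Theory.Cong"
    "HOL-Real_Asymp.Real_Asymp"
begin

text \<open>
  Modulo 2, \<open>\<Sigma>(q) = 1 + \<theta> + \<theta>\<^sup>2\<close> with \<open>\<theta> = \<Sum>\<^sub>m\<^sub>\<ge>\<^sub>1 q^(m\<^sup>2)\<close>, because \<open>\<sigma>(n)\<close> is odd iff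
  \<open>n\<close> is a square or twice a square.
  Let \<open>\<psi> = \<theta> + \<theta>\<^sup>4\<close> be the part of \<open>\<theta>\<close> with odd \<open>m\<close>; it equals \<open>(\<theta> + \<theta>\<^sup>2) \<Sigma>\<close>, so \<open>\<psi> / \<Sigma> = \<theta> + \<theta>\<^sup>2\<close>.
  Split \<open>\<psi> = \<psi>\<^sub>1 + \<psi>\<^sub>9\<close> according to the exponent modulo 16.
  Rotating \<open>a\<^sup>2 + b\<^sup>2\<close> by 45 degrees gives \<open>\<psi>\<^sub>1 \<psi>\<^sub>9 = \<psi>(q\<^sup>2) \<psi>(q^8) = \<psi>^10\<close>, so \<open>\<psi>\<^sub>9 / \<psi>\<close> and
  \<open>(\<theta> + \<theta>\<^sup>2)^8\<close> are both the root without constant term of \<open>Y\<^sup>2 + Y = \<psi>^8\<close>.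
  Hence \<open>1 / \<Sigma> = 1 + \<psi> + \<psi>\<^sup>3 + \<psi>\<^sub>9 / \<psi>(q\<^sup>2)\<close>, and all exponents of the last term are 7 modulo 16.

  The exponents of \<open>\<psi>\<close> are squares. The coefficient of \<open>\<psi>\<^sup>3 = \<psi>(q) \<psi>(q\<^sup>2)\<close> at \<open>n\<close> counts the positive
  solutions of \<open>x\<^sup>2 + 2 y\<^sup>2 = n\<close>. If an odd prime \<open>p\<close> divides \<open>n\<close> exactly once, there are either none
  or twice as many as for \<open>n / p\<close>, so the coefficient vanishes modulo 2 as soon as \<open>n\<close> is not \<open>p\<close> times a
  square. As the sum of the reciprocals of the primes diverges, almost every \<open>n\<close> has such a prime
  divisor, and \<open>\<psi>\<^sup>3\<close> contributes density zero.
\<close>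

unbundle fps_syntax

declare add_bit_eq_xor [simp del] mult_bit_eq_and [simp del]

section \<open>Power series over the field with two elements\<close>

lemma bit_add_self [simp]: "(a::bit) + a = 0"
  by (cases a) (simp_all add: add_bit_eq_xor)

lemma bit_fps_add_self [simp]: "(f::bit fps) + f = 0"
  by (rule fps_ext) (simp only: fps_add_nth bit_add_self fps_zero_nth)

lemma bit_fps_two [simp]: "(2::bit fps) = 0"
  using bit_fps_add_self[of 1] by (simp only: one_add_one)

lemma bit_fps_eq_iff_add: "(f::bit fps) = g \<longleftrightarrow> f + g = 0"
  by (metis add.assoc add.right_neutral bit_fps_add_self)

text \<open>Frobenius: in the convolution the terms at \<open>i\<close> and \<open>n - i\<close>
  cancel, only the middle one survives, and a bit equals its square. So squaring substitutes
  \<open>q^2\<close> for \<open>q\<close>.\<close>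

lemma bit_fps_square_nth:
  "((f::bit fps) ^ 2) $ n = (if even n then f $ (n div 2) else 0)"
proof -
  have "(\<Sum>i | i \<in> {0..n} \<and> 2 * i \<noteq> n. f $ i * f $ (n - i)) = 0"
  proof -
    have "(\<Sum>i | i \<in> {0..n} \<and> 2 * i < n. f $ i * f $ (n - i))
        = (\<Sum>i | i \<in> {0..n} \<and> n < 2 * i. f $ i * f $ (n - i))"
      by (rule sum.reindex_bij_witness[of _ "\<lambda>i. n - i" "\<lambda>i. n - i"])
        (auto simp: mult.commute)
    moreover have "{i. i \<in> {0..n} \<and> 2 * i \<noteq> n} =
        {i. i \<in> {0..n} \<and> 2 * i < n} \<union> {i. i \<in> {0..n} \<and> n < 2 * i}"
      by auto
    ultimately show ?thesis
      by (simp only:) (subst sum.union_disjoint, auto)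
  qed
  moreover have "(f ^ 2) $ n = (\<Sum>i | i \<in> {0..n} \<and> 2 * i \<noteq> n. f $ i * f $ (n - i))
      + (\<Sum>i | i \<in> {0..n} \<and> 2 * i = n. f $ i * f $ (n - i))"
    unfolding power2_eq_square fps_mult_nth
    by (subst sum.union_disjoint [symmetric]) (auto intro!: sum.cong)
  moreover have "{i. i \<in> {0..n} \<and> 2 * i = n} = (if even n then {n div 2} else {})"
    by auto
  moreover have "f $ k * f $ k = f $ k" for k
    by (cases "f $ k") simp_all
  ultimately show ?thesis
    by auto
qed

lemma bit_fps_power4_nth:
  "((f::bit fps) ^ 4) $ n = (if 4 dvd n then f $ (n div 4) else 0)"
proof -
  have "f ^ 4 = (f ^ 2) ^ 2"
    by simp
  moreover have "4 dvd n \<longleftrightarrow> even n \<and> even (n div 2)" "n div 2 div 2 = n div 4"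
    by presburger+
  ultimately show ?thesis
    by (simp only: bit_fps_square_nth) auto
qed

lemma bit_fps_power8_nth:
  "((f::bit fps) ^ 8) $ n = (if 8 dvd n then f $ (n div 8) else 0)"
proof -
  have "f ^ 8 = (f ^ 4) ^ 2"
    by simp
  moreover have "8 dvd n \<longleftrightarrow> even n \<and> 4 dvd (n div 2)" "n div 2 div 4 = n div 8"
    by presburger+
  ultimately show ?thesis
    by (simp only: bit_fps_square_nth bit_fps_power4_nth) auto
qed

lemma bit_fps_add_square: "((f::bit fps) + g) ^ 2 = f ^ 2 + g ^ 2"
  by (rule fps_ext) (simp add: bit_fps_square_nth)

lemma gen_fps_mult_nth:
  "(gen_fps X * gen_fps Y) $ n = of_nat (card {(a, b). a \<in> X \<and> b \<in> Y \<and> a + b = n})"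
proof -
  have "(gen_fps X * gen_fps Y) $ n
      = (\<Sum>i\<in>{0..n}. if i \<in> X \<and> n - i \<in> Y then 1 else 0)"
    unfolding fps_mult_nth by (intro sum.cong) auto
  also have "\<dots> = of_nat (card {i\<in>{0..n}. i \<in> X \<and> n - i \<in> Y})"
    by (subst sum.inter_filter [symmetric]) auto
  also have "card {i\<in>{0..n}. i \<in> X \<and> n - i \<in> Y}
      = card {(a, b). a \<in> X \<and> b \<in> Y \<and> a + b = n}"
    by (rule bij_betw_same_card [of "\<lambda>i. (i, n - i)"], rule bij_betwI [of _ _ _ fst]) auto
  finally show ?thesis .
qed

lemma even_card_iff_fixed_points:
  assumes "finite X" "\<And>x. x \<in> X \<Longrightarrow> h x \<in> X" "\<And>x. x \<in> X \<Longrightarrow> h (h x) = x"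
  shows "even (card X) \<longleftrightarrow> even (card {x \<in> X. h x = x})"
proof -
  let ?N = "{x \<in> X. h x \<noteq> x}"
  \<comment> \<open>The count modulo 2 is a sum of ones in \<open>bit\<close>, where
    \<open>x\<close> cancels against \<open>h x\<close>.\<close>
  have "(\<Sum>x\<in>?N. (1::bit)) = 0"
    using assms by (intro sum_involution_eq_0[of _ _ h]) auto
  then have "of_nat (card ?N) = (0::bit)" by simp
  then have "even (card ?N)"
    by (metis even_of_nat even_zero)
  moreover have "card X = card {x \<in> X. h x = x} + card ?N"
    using assms(1) by (subst card_Un_disjoint [symmetric]) (auto intro!: arg_cong[of _ _ card])
  ultimately show ?thesis by simp
qed

lemma odd_square_mod_8:
  assumes "odd (m::nat)"
  shows "m ^ 2 mod 8 = 1"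
proof -
  have "m mod 8 = 1 \<or> m mod 8 = 3 \<or> m mod 8 = 5 \<or> m mod 8 = 7" using assms by presburger
  then show ?thesis by (auto simp: power_mod [symmetric, of m])
qed

section \<open>The parity of the divisor sum\<close>

lemma odd_part_unique:
  assumes "2 ^ a * x = 2 ^ b * (y::nat)" "odd x" "odd y"
  shows "a = b" "x = y"
proof -
  have "multiplicity 2 (2 ^ a * x) = a" "multiplicity 2 (2 ^ b * y) = b"
    using assms(2,3) by (auto intro!: multiplicity_eqI)
  then show "a = b" using assms(1) by metis
  then show "x = y" using assms(1) by simp
qed

text \<open>The exponent of 2 is even on the left and odd on the right. This keeps squares and
  doubled squares from cancelling modulo 2.\<close>

lemma square_neq_twice_square:
  assumes "m > (0::nat)"
  shows "m ^ 2 \<noteq> 2 * k ^ 2"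
proof
  assume eq: "m ^ 2 = 2 * k ^ 2"
  then have "k > 0" using assms by (cases k) auto
  then obtain j y where k: "k = 2 ^ j * y" "odd y"
    using multiplicity_decompose'[of k 2] by (metis gr_implies_not0 prime_elem_not_unit prime_imp_prime_elem two_is_prime_nat)
  obtain i x where m: "m = 2 ^ i * x" "odd x"
    using assms multiplicity_decompose'[of m 2]
    by (metis gr_implies_not0 prime_elem_not_unit prime_imp_prime_elem two_is_prime_nat)
  have "2 ^ (2 * i) * x ^ 2 = 2 ^ (2 * j + 1) * y ^ 2"
    using eq by (simp add: m k power_mult_distrib mult.commute[of 2] flip: power_mult)
  then have "2 * i = 2 * j + 1"
    by (rule odd_part_unique) (use m k in auto)
  then show False by presburger
qed

text \<open>Modulo 2 only the odd divisors count, which are the divisors of the odd part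
  \<open>m\<close>. Pairing \<open>d\<close> with \<open>m div d\<close> fixes only a square root of
  \<open>m\<close>, so their number is odd iff \<open>m\<close> is a square. The parity of
  \<open>k\<close> then decides between a square and twice a square.\<close>

lemma odd_divisor_sum_iff:
  assumes "n > 0"
  shows "odd (divisor_sum n) \<longleftrightarrow> (\<exists>m. n = m ^ 2 \<or> n = 2 * m ^ 2)"
proof -
  obtain k m where n: "n = 2 ^ k * m" and m: "odd m"
    using assms by (metis dvd_refl gr_implies_not0 multiplicity_decompose' not_is_unit_0 odd_one prime_elem_multiplicity_eq_zero_iff)
  let ?D = "{d. d dvd m}"
  have m0: "m > 0" using m by (cases m) auto
  have fin: "finite {d. d dvd n}" "finite ?D" using assms m0 by auto
  have D: "{d \<in> {d. d dvd n}. odd d} = ?D"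
    using m by (auto simp: n coprime_dvd_mult_right_iff coprime_power_right_iff intro: dvd_trans)
  have "odd (divisor_sum n) \<longleftrightarrow> odd (card {d \<in> {d. d dvd n}. odd d})"
    unfolding divisor_sum_def by (simp add: even_sum_iff fin)
  also have "\<dots> \<longleftrightarrow> odd (card {d \<in> ?D. m div d = d})"
    unfolding D by (subst even_card_iff_fixed_points[where h = "\<lambda>d. m div d"]) (use m0 in auto)
  also have "\<dots> \<longleftrightarrow> (\<exists>d. m = d ^ 2)"
  proof (cases "\<exists>d. m = d ^ 2")
    case True
    then obtain d where d: "m = d ^ 2" by auto
    have "m div e = e \<longleftrightarrow> e = d" if "e dvd m" for e
    proof
      assume "m div e = e"
      then have "e ^ 2 = d ^ 2"
        using dvd_mult_div_cancel[OF that] d by (simp add: power2_eq_square)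
      then show "e = d" by simp
    next
      assume "e = d"
      then show "m div e = e" using d m0 by (simp add: power2_eq_square)
    qed
    then have "{e \<in> ?D. m div e = e} = {d}"
      using d by auto
    then show ?thesis using True by simp
  next
    case False
    then have "{e \<in> ?D. m div e = e} = {}"
      by (auto simp: power2_eq_square) (metis dvd_div_mult_self)
    then show ?thesis using False by (simp only: card.empty) simp
  qed
  also have "\<dots> \<longleftrightarrow> (\<exists>m. n = m ^ 2 \<or> n = 2 * m ^ 2)"
  proof
    assume "\<exists>d. m = d ^ 2"
    then obtain d where d: "m = d ^ 2" by blast
    show "\<exists>m. n = m ^ 2 \<or> n = 2 * m ^ 2"
    proof (cases "even k")
      case True
      then have "n = (2 ^ (k div 2) * d) ^ 2"
        by (auto simp: n d power_mult_distrib elim!: evenE simp flip: power_mult)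
      then show ?thesis by blast
    next
      case False
      then have "n = 2 * (2 ^ (k div 2) * d) ^ 2"
        by (auto simp: n d power_mult_distrib mult.commute[of 2] elim!: oddE simp flip: power_mult)
      then show ?thesis by blast
    qed
  next
    assume "\<exists>m. n = m ^ 2 \<or> n = 2 * m ^ 2"
    then obtain l where l: "n = l ^ 2 \<or> n = 2 * l ^ 2" by blast
    with assms have "l > 0" by (cases l) auto
    then obtain j y where y: "l = 2 ^ j * y" "odd y"
      using multiplicity_decompose'[of l 2]
      by (metis gr_implies_not0 prime_elem_not_unit prime_imp_prime_elem two_is_prime_nat)
    from l have "2 ^ k * m = 2 ^ (2 * j) * y ^ 2 \<or> 2 ^ k * m = 2 ^ (2 * j + 1) * y ^ 2"
      by (simp add: n y power_mult_distrib mult_ac flip: power_mult)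
    then have "m = y ^ 2"
      using odd_part_unique(2)[of k m] m y(2) by (metis even_power)
    then show "\<exists>d. m = d ^ 2" by blast
  qed
  finally show ?thesis .
qed

section \<open>Theta series modulo 2 and their identities\<close>

definition theta :: "bit fps" where "theta = gen_fps {m ^ 2 | m. m > 0}"
definition psi :: "bit fps" where "psi = gen_fps {m ^ 2 | m. odd m}"
text \<open>Of the two roots of an odd square exactly one is 1 or 3 modulo 8, and the square is then
  1 or 9 modulo 16, respectively. Fixing the sign of the root lets exponents be counted as integers
  \<open>a\<close>.\<close>

definition psi1 :: "bit fps" where "psi1 = gen_fps {nat (a ^ 2) | a. a mod 8 = 1}"
definition psi9 :: "bit fps" where "psi9 = gen_fps {nat (a ^ 2) | a. a mod 8 = 3}"

lemma gen_fps_odd_sigma_set: "gen_fps odd_sigma_set = 1 + theta + theta ^ 2"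
proof (rule fps_ext)
  fix n :: nat
  define P Q where "P \<longleftrightarrow> (\<exists>m>0. n = m ^ 2)" and "Q \<longleftrightarrow> (\<exists>m>0. n = 2 * m ^ 2)"
  have "theta $ n = of_bool P"
    unfolding theta_def P_def gen_fps_nth by (rule arg_cong [of _ _ of_bool]) auto
  moreover have "(even n \<and> (\<exists>m>0. n div 2 = m ^ 2)) \<longleftrightarrow> Q"
    unfolding Q_def by auto
  then have "(theta ^ 2) $ n = of_bool Q"
    by (auto simp: bit_fps_square_nth theta_def)
  moreover have "n \<in> odd_sigma_set \<longleftrightarrow> n = 0 \<or> P \<or> Q"
    using odd_divisor_sum_iff[of n] unfolding P_def Q_def odd_sigma_set_def
    by (cases "n = 0") auto
  moreover have "\<not> (P \<and> Q)"
    unfolding P_def Q_def using square_neq_twice_square by blast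
  moreover have "\<not> P" "\<not> Q" if "n = 0"
    using that by (auto simp: P_def Q_def)
  ultimately show "gen_fps odd_sigma_set $ n = (1 + theta + theta ^ 2) $ n"
    by (cases "n = 0"; cases P; cases Q) simp_all
qed

text \<open>\<open>theta ^ 4\<close> is \<open>theta\<close> at \<open>q^4\<close>, hence the part
  of \<open>theta\<close> with even \<open>m\<close>.\<close>

lemma theta_eq: "theta = psi + theta ^ 4"
proof (rule fps_ext)
  fix n :: nat
  have eq: "(\<exists>m>0. n = m ^ 2) \<longleftrightarrow> (\<exists>m. n = m ^ 2 \<and> odd m) \<or> (4 dvd n \<and> (\<exists>m>0. n div 4 = m ^ 2))"
    (is "?L \<longleftrightarrow> ?O \<or> ?E")
  proof
    assume ?L
    then obtain m where m: "m > 0" "n = m ^ 2" by blast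
    show "?O \<or> ?E"
    proof (cases "even m")
      case True
      then obtain k where "m = 2 * k" by blast
      with m have "4 dvd n" "n div 4 = k ^ 2" "k > 0"
        by (auto simp: power_mult_distrib)
      then show ?thesis by blast
    qed (use m in blast)
  next
    assume "?O \<or> ?E"
    then show ?L
    proof
      assume ?O
      then show ?L using odd_pos by blast
    next
      assume ?E
      then obtain m where "4 dvd n" "m > 0" "n div 4 = m ^ 2" by blast
      then have "n = (2 * m) ^ 2" "2 * m > 0" by (auto simp: power_mult_distrib)
      then show ?L by blast
    qed
  qed
  have "odd n" if "\<exists>m. n = m ^ 2 \<and> odd m"
    using that by auto
  moreover have "even n" if "4 dvd n"
    using that by presburger
  ultimately have "\<not> ((\<exists>m. n = m ^ 2 \<and> odd m) \<and> 4 dvd n)"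
    by blast
  with eq show "theta $ n = (psi + theta ^ 4) $ n"
    unfolding theta_def psi_def
    by (auto simp: bit_fps_power4_nth)
qed

lemma psi_eq_theta: "psi = theta + theta ^ 4"
  using theta_eq by (metis add.commute add.left_commute add.right_neutral bit_fps_add_self)

lemma psi_eq_psi1_psi9: "psi = psi1 + psi9"
proof (rule fps_ext)
  fix n :: nat
  have "(\<exists>m. n = m ^ 2 \<and> odd m) \<longleftrightarrow>
      (\<exists>a::int. n = nat (a ^ 2) \<and> a mod 8 = 1) \<or> (\<exists>a::int. n = nat (a ^ 2) \<and> a mod 8 = 3)"
    (is "_ \<longleftrightarrow> ?A \<or> ?B")
  proof
    assume "\<exists>m. n = m ^ 2 \<and> odd m"
    then obtain m where m: "n = m ^ 2" "odd m" by blast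
    have n: "n = nat (int m ^ 2)" "n = nat ((- int m) ^ 2)"
      by (simp_all add: m nat_power_eq)
    have "int m mod 8 = 1 \<or> int m mod 8 = 3 \<or> (- int m) mod 8 = 1 \<or> (- int m) mod 8 = 3"
      using m(2) by presburger
    then show "?A \<or> ?B" using n by blast
  next
    assume "?A \<or> ?B"
    then obtain a :: int where a: "n = nat (a ^ 2)" "a mod 8 = 1 \<or> a mod 8 = 3" by blast
    then have "n = (nat \<bar>a\<bar>) ^ 2" by (simp flip: nat_power_eq)
    moreover have "odd a" using a(2) by presburger
    then have "odd (nat \<bar>a\<bar>)" by (simp add: even_nat_iff)
    ultimately show "\<exists>m. n = m ^ 2 \<and> odd m" by blast
  qed
  \<comment> \<open>An exponent common to both series would cancel modulo 2.\<close>
  moreover have "\<not> (?A \<and> ?B)"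
  proof safe
    fix a b :: int
    assume "nat (a ^ 2) = nat (b ^ 2)" and ab: "a mod 8 = 1" "b mod 8 = 3"
    then have "a = b \<or> a = - b" by (simp add: power2_eq_iff eq_nat_nat_iff)
    then show False using ab by presburger
  qed
  ultimately show "psi $ n = (psi1 + psi9) $ n"
    unfolding psi_def psi1_def psi9_def by auto
qed

text \<open>The rotation is \<open>a = v + 2 * w\<close>, \<open>b = 2 * w - v\<close>. It is
  integral because \<open>a - b\<close> is even and \<open>a + b\<close> is 4 modulo 8, which also
  makes \<open>w\<close> odd. Conversely \<open>v - 2 * w\<close> is \<open>- b\<close>, and
  \<open>a\<close> exceeds it by \<open>4 * w\<close>, which is 4 modulo 8.\<close>

lemma bij_betw_sum_two_squares_residues:
  fixes n :: nat
  shows "bij_betw (\<lambda>(a, b). ((a - b) div 2, (a + b) div 4))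
    {(a::int, b). a mod 8 = 1 \<and> b mod 8 = 3 \<and> a ^ 2 + b ^ 2 = int n}
    {(v::int, w). odd w \<and> (v - 2 * w) mod 8 = 5 \<and> 2 * v ^ 2 + 8 * w ^ 2 = int n}"
proof (rule bij_betwI[of _ _ _ "\<lambda>(v, w). (v + 2 * w, 2 * w - v)"], goal_cases)
  case 1
  show ?case
  proof (clarsimp, intro conjI)
    fix a b :: int
    assume ab: "a mod 8 = 1" "b mod 8 = 3" "a ^ 2 + b ^ 2 = int n"
    define v w where "v = (a - b) div 2" and "w = (a + b) div 4"
    have e: "a = v + 2 * w" "b = 2 * w - v"
      unfolding v_def w_def using ab(1,2) by presburger+
    show "odd ((a + b) div 4)" using ab(1,2) by presburger
    show "((a - b) div 2 - 2 * ((a + b) div 4)) mod 8 = 5" using ab(1,2) by presburger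
    show "2 * ((a - b) div 2) ^ 2 + 8 * ((a + b) div 4) ^ 2 = int n"
      unfolding v_def[symmetric] w_def[symmetric] ab(3)[symmetric] e
      by (simp add: power2_eq_square algebra_simps)
  qed
next
  case 2
  show ?case
  proof (clarsimp, intro conjI)
    fix v w :: int
    assume vw: "odd w" "(v - 2 * w) mod 8 = 5" "2 * v ^ 2 + 8 * w ^ 2 = int n"
    show "(v + 2 * w) mod 8 = 1" "(2 * w - v) mod 8 = 3" using vw(1,2) by presburger+
    show "(v + 2 * w) ^ 2 + (2 * w - v) ^ 2 = int n"
      unfolding vw(3)[symmetric] by (simp add: power2_eq_square algebra_simps)
  qed
next
  case (3 x)
  then show ?case by (auto; presburger)
next
  case (4 y)
  then show ?case by auto
qed

lemma psi_square: "psi ^ 2 = gen_fps {2 * m ^ 2 | m. odd m}"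
  by (rule fps_ext) (auto simp: psi_def bit_fps_square_nth elim!: evenE)

text \<open>The rotation matches \<open>?P\<close> with \<open>?Q\<close>. The congruence on
  \<open>v - 2 * w\<close> selects exactly one of the four sign choices for each pair of odd roots,
  so \<open>?Q\<close> counts the coefficient of \<open>psi ^ 2 * psi ^ 8\<close>.\<close>

lemma psi1_psi9: "psi1 * psi9 = psi ^ 10"
proof (rule fps_ext)
  fix n
  let ?P = "{(a::int, b). a mod 8 = 1 \<and> b mod 8 = 3 \<and> a ^ 2 + b ^ 2 = int n}"
  let ?Q = "{(v::int, w). odd w \<and> (v - 2 * w) mod 8 = 5 \<and> 2 * v ^ 2 + 8 * w ^ 2 = int n}"
  let ?X = "{nat (a ^ 2) |a. a mod 8 = 1}" and ?Y = "{nat (a ^ 2) |a. a mod 8 = 3}"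
  let ?Z = "{m ^ 2 |m::nat. odd m}"
  have "bij_betw (\<lambda>(a, b). (nat (a ^ 2), nat (b ^ 2))) ?P {(x, y). x \<in> ?X \<and> y \<in> ?Y \<and> x + y = n}"
    unfolding bij_betw_def
  proof (intro conjI inj_onI subset_antisym subsetI, goal_cases)
    case (1 x y)
    obtain a b a' b' where xy: "x = (a, b)" "y = (a', b')" by force
    with 1 have eq: "a = a' \<or> a = - a'" "b = b' \<or> b = - b'"
      by (auto simp: eq_nat_nat_iff power2_eq_iff)
    have "a mod 8 = 1" "a' mod 8 = 1" "b mod 8 = 3" "b' mod 8 = 3" using 1 xy by auto
    from eq(1) this(1,2) have "a = a'" by presburger
    moreover from eq(2) \<open>b mod 8 = 3\<close> \<open>b' mod 8 = 3\<close> have "b = b'" by presburger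
    ultimately show ?case by (simp add: xy)
  next
    case (2 x)
    then show ?case by (auto simp flip: nat_add_distrib)
  next
    case (3 x)
    then obtain a b :: int where "x = (nat (a ^ 2), nat (b ^ 2))" "a mod 8 = 1" "b mod 8 = 3"
      "nat (a ^ 2) + nat (b ^ 2) = n" by auto
    moreover from this(4) have "a ^ 2 + b ^ 2 = int n"
      by (simp add: nat_eq_iff flip: nat_add_distrib)
    ultimately show ?case by (intro rev_image_eqI[of "(a, b)"]) auto
  qed
  then have 1: "(psi1 * psi9) $ n = of_nat (card ?P)"
    unfolding psi1_def psi9_def gen_fps_mult_nth by (simp add: bij_betw_same_card)
  have psi2: "psi ^ 2 = gen_fps {2 * m | m. m \<in> ?Z}"
    by (rule fps_ext) (auto simp: psi_def bit_fps_square_nth elim!: evenE)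
  have psi8: "psi ^ 8 = gen_fps {8 * m | m. m \<in> ?Z}"
    by (rule fps_ext) (auto simp: psi_def bit_fps_power8_nth elim!: dvdE)
  have "bij_betw (\<lambda>(v, w). (nat (2 * v ^ 2), nat (8 * w ^ 2))) ?Q
    {(x, y). x \<in> {2 * m | m. m \<in> ?Z} \<and> y \<in> {8 * m | m. m \<in> ?Z} \<and> x + y = n}"
    unfolding bij_betw_def
  proof (intro conjI inj_onI subset_antisym subsetI, goal_cases)
    case (1 x y)
    obtain a b a' b' where xy: "x = (a, b)" "y = (a', b')" by force
    with 1 have eq: "a = a' \<or> a = - a'" "b = b' \<or> b = - b'"
      by (auto simp: eq_nat_nat_iff power2_eq_iff)
    have odd: "odd b" "odd b'" and res: "(a - 2 * b) mod 8 = 5" "(a' - 2 * b') mod 8 = 5"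
      using 1 xy by auto
    \<comment> \<open>As the second entry is odd, the first is 3 modulo 4, which fixes its
      sign.\<close>
    have "a mod 4 = 3" using odd(1) res(1) by presburger
    moreover have "a' mod 4 = 3" using odd(2) res(2) by presburger
    ultimately have a: "a = a'" using eq(1) by presburger
    \<comment> \<open>Negating an odd second entry changes \<open>a - 2 * b\<close> by 4 modulo
      8.\<close>
    have False if "b = - b'"
      using res odd(2) unfolding a that by presburger
    with eq(2) have "b = b'" by blast
    with a show ?case by (simp add: xy)
  next
    case (2 x)
    then obtain v w where vw: "odd w" "(v - 2 * w) mod 8 = 5" "2 * v ^ 2 + 8 * w ^ 2 = int n"
      and x: "x = (nat (2 * v ^ 2), nat (8 * w ^ 2))" by auto
    have "odd v" using vw(2) by presburger
    then have "odd (nat \<bar>v\<bar>)" "odd (nat \<bar>w\<bar>)" using vw(1) by (simp_all add: even_nat_iff)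
    moreover have "nat (2 * v ^ 2) = 2 * nat \<bar>v\<bar> ^ 2" "nat (8 * w ^ 2) = 8 * nat \<bar>w\<bar> ^ 2"
      by (simp_all add: nat_mult_distrib flip: nat_power_eq)
    moreover have "nat (2 * v ^ 2) + nat (8 * w ^ 2) = n"
      using vw(3) by (simp flip: nat_add_distrib)
    ultimately show ?case unfolding x by blast
  next
    case (3 x)
    then obtain c d where cd: "odd c" "odd d" "x = (2 * c ^ 2, 8 * d ^ 2)" "2 * c ^ 2 + 8 * d ^ 2 = n"
      by auto
    obtain v t where v: "v ^ 2 = int (c ^ 2)" and t: "v = 4 * t + 3"
    proof (cases "c mod 4 = 3")
      case True
      then have "int c = 4 * int (c div 4) + 3"
        using div_mult_mod_eq [of c 4] by linarith
      with that [of "int c"] show thesis by simp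
    next
      case False
      with cd(1) have "c mod 4 = 1" by presburger
      then have "int c = 4 * int (c div 4) + 1"
        using div_mult_mod_eq [of c 4] by linarith
      then have "- int c = 4 * (- int (c div 4) - 1) + 3" by simp
      from that [OF _ this] show thesis by simp
    qed
    obtain e where e: "int d = 2 * e + 1" using cd(2) by (auto elim!: oddE)
    \<comment> \<open>Since \<open>v + 2 * int d = 4 * (t + e) + 5\<close>, the parity of
      \<open>t + e\<close> decides the sign of \<open>w\<close>.\<close>
    obtain w where w: "odd w" "(v - 2 * w) mod 8 = 5" "w ^ 2 = int (d ^ 2)"
    proof (cases "even (t + e)")
      case True
      then obtain u where "t + e = 2 * u" by blast
      then have "v - 2 * (- int d) = 5 + u * 8" unfolding t e by simp
      then have "(v - 2 * (- int d)) mod 8 = 5" by (simp only: mod_mult_self1) simp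
      then show thesis using that [of "- int d"] cd(2) by simp
    next
      case False
      then obtain u where "t + e = 2 * u + 1" by (rule oddE)
      then have "v - 2 * int d = 5 + (u - e) * 8" unfolding t e by simp
      then have "(v - 2 * int d) mod 8 = 5" by (simp only: mod_mult_self1) simp
      then show thesis using that [of "int d"] cd(2) by simp
    qed
    note sq = v w(3)
    have "2 * v ^ 2 + 8 * w ^ 2 = int n" by (simp add: sq flip: cd(4))
    moreover have "x = (nat (2 * v ^ 2), nat (8 * w ^ 2))"
      unfolding sq cd(3) by (simp add: nat_mult_distrib nat_power_eq)
    ultimately show ?case using w(1,2) by (intro rev_image_eqI[of "(v, w)"]) auto
  qed
  then have "(psi ^ 2 * psi ^ 8) $ n = of_nat (card ?Q)"
    unfolding psi2 psi8 gen_fps_mult_nth by (simp add: bij_betw_same_card)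
  moreover have "card ?P = card ?Q"
    using bij_betw_sum_two_squares_residues by (rule bij_betw_same_card)
  ultimately show "(psi1 * psi9) $ n = psi ^ 10 $ n"
    using 1 by (simp flip: power_add)
qed

section \<open>The reciprocal series and the support of its remainder\<close>

definition reciprocal_odd_sigma :: "bit fps" where
  "reciprocal_odd_sigma = gen_fps (reciprocal_set odd_sigma_set)"

text \<open>Modulo 2, \<open>theta + theta ^ 4\<close> is \<open>theta + theta ^ 2\<close> times
  \<open>1 + theta + theta ^ 2\<close>, and the reciprocal cancels the second factor.\<close>

lemma psi_reciprocal: "psi * reciprocal_odd_sigma = theta + theta ^ 2"
proof -
  have "0 \<in> odd_sigma_set" by (simp add: odd_sigma_set_def)
  then have inv: "(1 + theta + theta ^ 2) * reciprocal_odd_sigma = 1"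
    unfolding reciprocal_odd_sigma_def gen_fps_odd_sigma_set [symmetric]
    by (rule gen_fps_reciprocal_set)
  have "psi = theta + theta ^ 4" by (rule psi_eq_theta)
  also have "\<dots> = (theta + theta ^ 2) * (1 + theta + theta ^ 2)"
  proof -
    have "(theta + theta ^ 2) * (1 + theta + theta ^ 2) = theta + theta ^ 4 + 2 * (theta ^ 2 + theta ^ 3)"
      by algebra
    then show ?thesis by simp
  qed
  finally show ?thesis using inv by (metis mult.assoc mult.right_neutral)
qed

text \<open>Both \<open>psi9\<close> and \<open>psi * E\<close> solve
  \<open>X^2 + psi * X = psi^10\<close>, so they are equal or differ by \<open>psi\<close>; the
  coefficient at 1 decides.\<close>

lemma psi9_eq_psi_times_theta: "psi9 = psi * (theta + theta ^ 2) ^ 8"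
proof -
  define E where "E = (theta + theta ^ 2) ^ 8"
  have pow8: "(f + g) ^ 8 = f ^ 8 + g ^ 8" for f g :: "bit fps"
  proof -
    have "(f + g) ^ 8 = (((f + g) ^ 2) ^ 2) ^ 2" by (simp flip: power_mult)
    then show ?thesis by (simp only: bit_fps_add_square) (simp flip: power_mult)
  qed
  have "E + E ^ 2 = theta ^ 8 + theta ^ 16 + theta ^ 16 + theta ^ 32"
    unfolding E_def pow8 bit_fps_add_square by (simp add: add.assoc flip: power_mult)
  also have "\<dots> = theta ^ 8 + theta ^ 32"
    by (simp add: add.assoc)
  also have "\<dots> = psi ^ 8"
    unfolding psi_eq_theta pow8 by (simp flip: power_mult)
  finally have E: "E + E ^ 2 = psi ^ 8" .
  have "(psi9 + psi * E) * (psi9 + psi * E + psi)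
      = psi9 * (psi9 + psi) + psi ^ 2 * (E + E ^ 2) + 2 * (psi9 * psi * E)"
    by algebra
  also have "psi9 + psi = psi1"
    unfolding psi_eq_psi1_psi9 by (simp add: add.commute add.left_commute)
  also have "psi9 * psi1 + psi ^ 2 * (E + E ^ 2) + 2 * (psi9 * psi * E) = 0"
    using psi1_psi9 unfolding E by (simp add: mult.commute flip: power_add)
  finally have "psi9 + psi * E = 0 \<or> psi9 + psi * E + psi = 0"
    by simp
  \<comment> \<open>Only the last summand contributes: 1 is not an exponent of \<open>psi9\<close>,
    and neither factor of \<open>psi * E\<close> has a constant term.\<close>
  moreover have "(psi9 + psi * E + psi) $ 1 \<noteq> 0"
  proof -
    have psi0: "psi $ 0 = 0" "psi $ Suc 0 = 1" by (auto simp: psi_def odd_pos intro: exI[of _ 1])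
    have "psi9 $ 1 = 0"
    proof -
      have False if "1 = nat (a ^ 2)" "a mod 8 = 3" for a :: int
      proof -
        have "a ^ 2 = 1" using that(1) by linarith
        then have "a = 1 \<or> a = - 1" by (simp add: power2_eq_1_iff)
        then show False using that(2) by auto
      qed
      then show ?thesis by (auto simp: psi9_def)
    qed
    moreover have "E $ 0 = 0" by (simp add: E_def theta_def)
    ultimately show ?thesis by (simp add: fps_mult_nth psi0)
  qed
  ultimately have "psi9 + psi * E = 0"
    by (metis fps_zero_nth)
  then show ?thesis
    unfolding E_def[symmetric] by (rule bit_fps_eq_iff_add[THEN iffD2])
qed

text \<open>One factor \<open>psi\<close> clears the reciprocal; the remaining sum telescopes to
  \<open>theta ^ 8 + theta ^ 16\<close> because \<open>psi = theta + theta ^ 4\<close>.\<close>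

lemma reciprocal_remainder:
  "psi ^ 2 * (reciprocal_odd_sigma + 1 + psi + psi ^ 3) = psi9"
proof -
  have "psi ^ 2 * (reciprocal_odd_sigma + 1 + psi + psi ^ 3)
      = psi * (psi * reciprocal_odd_sigma + psi + psi ^ 2 + psi ^ 4)"
    by algebra
  also have "psi * reciprocal_odd_sigma + psi + psi ^ 2 + psi ^ 4 = (theta + theta ^ 2) ^ 8"
  proof -
    have "f ^ 4 = (f ^ 2) ^ 2" "f ^ 8 = ((f ^ 2) ^ 2) ^ 2" for f :: "bit fps"
      by (simp_all flip: power_mult)
    then have "psi * reciprocal_odd_sigma + psi + psi ^ 2 + psi ^ 4 + (theta + theta ^ 2) ^ 8
       = 2 * (theta + theta ^ 2 + theta ^ 4 + theta ^ 8 + theta ^ 16)"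
      unfolding psi_reciprocal unfolding psi_eq_theta
      by (simp only: bit_fps_add_square) (simp add: algebra_simps flip: power_mult)
    then show ?thesis by (subst bit_fps_eq_iff_add) simp
  qed
  finally show ?thesis by (simp add: psi9_eq_psi_times_theta)
qed

text \<open>The exponents of \<open>psi ^ 2\<close> are 2 modulo 16, starting with 2 itself, and
  those of \<open>psi9\<close> are 9 modulo 16. The induction divides one by the other, coefficient
  by coefficient.\<close>

lemma reciprocal_remainder_support:
  assumes "(reciprocal_odd_sigma + 1 + psi + psi ^ 3) $ n \<noteq> 0"
  shows "n mod 16 = 7"
  using assms
proof (induction n rule: less_induct)
  case (less n)
  have mod16: "n mod 16 = 7" if "(n + 2) mod 16 = 9"
  proof -
    have "n = 7 + ((n + 2) div 16) * 16"
      using that div_mult_mod_eq [of "n + 2" 16] by linarith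
    then have "n mod 16 = 7 mod 16" by (metis mod_mult_self1)
    then show ?thesis by simp
  qed
  define W where "W = reciprocal_odd_sigma + 1 + psi + psi ^ 3"
  have psi2: "i mod 16 = 2" if "(psi ^ 2) $ i \<noteq> 0" for i
  proof -
    have "even i" and "psi $ (i div 2) \<noteq> 0"
      using that by (auto simp: bit_fps_square_nth split: if_splits)
    then obtain m where "i div 2 = m ^ 2" "odd m"
      by (auto simp: psi_def split: if_splits)
    then have "2 * (i div 2 mod 8) = 2" by (simp add: odd_square_mod_8)
    with \<open>even i\<close> show ?thesis by (simp add: mult_mod_right)
  qed
  show ?case
  proof (rule ccontr)
    assume n: "n mod 16 \<noteq> 7"
    have "psi9 $ (n + 2) = (\<Sum>i=0..n + 2. (psi ^ 2) $ i * W $ (n + 2 - i))"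
      unfolding W_def reciprocal_remainder [symmetric] fps_mult_nth ..
    \<comment> \<open>For \<open>i > 2\<close> the index into \<open>W\<close> is below
      \<open>n\<close>; by induction a nonzero term forces \<open>n + 2\<close> to be 9 modulo 16,
      against the choice of \<open>n\<close>.\<close>
    also have "\<dots> = (\<Sum>i\<in>{2}. (psi ^ 2) $ i * W $ (n + 2 - i))"
    proof (rule sum.mono_neutral_right)
      show "\<forall>i\<in>{0..n + 2} - {2}. (psi ^ 2) $ i * W $ (n + 2 - i) = 0"
      proof
        fix i assume i: "i \<in> {0..n + 2} - {2}"
        show "(psi ^ 2) $ i * W $ (n + 2 - i) = 0"
        proof (rule ccontr)
          assume nz: "(psi ^ 2) $ i * W $ (n + 2 - i) \<noteq> 0"
          then have "(psi ^ 2) $ i \<noteq> 0" and W: "W $ (n + 2 - i) \<noteq> 0"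
            by (metis mult_zero_left, metis mult_zero_right)
          then have i16: "i mod 16 = 2" by (intro psi2)
          from i have "i \<noteq> 2" "i \<le> n + 2" by auto
          moreover have "2 \<le> i" using mod_less_eq_dividend [of i 16] i16 by simp
          ultimately have "n + 2 - i < n" by linarith
          then have "(n + 2 - i) mod 16 = 7"
            by (rule less.IH [folded W_def, OF _ W])
          with i16 have "(i + (n + 2 - i)) mod 16 = 9"
            by (subst mod_add_eq [symmetric]) simp
          with \<open>i \<le> n + 2\<close> have "(n + 2) mod 16 = 9" by simp
          with n show False using mod16 by blast
        qed
      qed
    qed auto
    also have "(psi ^ 2) $ 2 = 1"
      by (auto simp: bit_fps_square_nth psi_def intro: exI [of _ 1])
    then have "(\<Sum>i\<in>{2}. (psi ^ 2) $ i * W $ (n + 2 - i)) = W $ n"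
      by simp
    finally have "psi9 $ (n + 2) \<noteq> 0" using less.prems unfolding W_def by simp
    then obtain a :: int where a: "n + 2 = nat (a ^ 2)" "a mod 8 = 3"
      by (auto simp: psi9_def split: if_splits)
    define k where "k = a div 8"
    have "a = 8 * k + 3" using a(2) div_mult_mod_eq [of a 8] by (simp add: k_def)
    then have "a ^ 2 = 9 + (4 * k ^ 2 + 3 * k) * 16"
      by (simp add: power2_eq_square algebra_simps)
    then have "a ^ 2 mod 16 = 9" by (simp only: mod_mult_self1) simp
    moreover have "a ^ 2 = int (n + 2)" using a(1) by simp
    ultimately have "int ((n + 2) mod 16) = int 9" by (simp add: zmod_int)
    then have "(n + 2) mod 16 = 9" by (simp only: of_nat_eq_iff)
    then show False using n mod16 by blast
  qed
qed

section \<open>Representations by the form $x^2 + 2y^2$\<close>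

text \<open>The elements \<open>x + y sqrt(-2)\<close> of norm \<open>n\<close>. Keeping both signs
  lets multiplication in this ring act on them.\<close>

definition norm_reps :: "int \<Rightarrow> (int \<times> int) set" where
  "norm_reps n = {(x, y). x ^ 2 + 2 * y ^ 2 = n}"

lemma finite_norm_reps: "finite (norm_reps n)"
proof (rule finite_subset)
  have le: "\<bar>x\<bar> \<le> x ^ 2" for x :: int
  proof (cases "x = 0")
    case False
    then have "\<bar>x\<bar> * 1 \<le> \<bar>x\<bar> * \<bar>x\<bar>" by (intro mult_left_mono) auto
    then show ?thesis by (simp add: power2_eq_square)
  qed simp
  show "norm_reps n \<subseteq> {-n..n} \<times> {-n..n}"
  proof
    fix z assume "z \<in> norm_reps n"
    then obtain x y where xy: "z = (x, y)" "x ^ 2 + 2 * y ^ 2 = n"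
      by (auto simp: norm_reps_def)
    then have "\<bar>x\<bar> \<le> n" "\<bar>y\<bar> \<le> n"
      using le[of x] le[of y] zero_le_power2[of x] zero_le_power2[of y] by linarith+
    then show "z \<in> {-n..n} \<times> {-n..n}" by (simp add: xy(1) abs_le_iff)
  qed
qed simp

text \<open>For small \<open>g\<close>, \<open>h\<close> with \<open>g * b\<close> congruent to
  \<open>h * a\<close>, the prime divides \<open>b ^ 2 * (g ^ 2 + 2 * h ^ 2)\<close>, hence the
  second factor. That factor is positive and below \<open>3 * p\<close>, so it is \<open>p\<close>
  or \<open>2 * p\<close>.\<close>

lemma prime_eq_square_plus_twice_square:
  fixes p :: nat and a b :: int
  assumes p: "prime p" "odd p" and dvd: "int p dvd a ^ 2 + 2 * b ^ 2" and b: "\<not> int p dvd b"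
  obtains g h :: int where "g ^ 2 + 2 * h ^ 2 = int p"
proof -
  have pint: "prime (int p)" using p(1) by simp
  define k where "k = floor_sqrt p"
  have k: "k ^ 2 \<le> p" "p < (Suc k) ^ 2"
    unfolding k_def by (simp_all only: floor_sqrt_power2_le Suc_floor_sqrt_power2_gt)
  \<comment> \<open>Strictness here is what excludes the multiple \<open>3 * p\<close>
    later.\<close>
  have "k ^ 2 \<noteq> p"
    using p(1) by (metis prime_power_iff numeral_eq_one_iff semiring_norm(85))
  with k have k2: "k ^ 2 < p" by simp
  \<comment> \<open>Thue's pigeonhole argument yields small \<open>g\<close>, \<open>h\<close> with \<open>g / h = a / b\<close> modulo \<open>p\<close>.\<close>
  define F where "F = (\<lambda>(i, j). (i * b - j * a) mod int p)"
  let ?D = "{0..int k} \<times> {0..int k}"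
  have "\<not> inj_on F ?D"
  proof
    assume "inj_on F ?D"
    moreover have "F ` ?D \<subseteq> {0..<int p}"
      using p(1) by (auto simp: F_def prime_gt_0_nat)
    ultimately have "card ?D \<le> card {0..<int p}"
      by (intro card_inj_on_le) auto
    moreover have "card {0..int k} = Suc k" by simp
    ultimately have "Suc k * Suc k \<le> p" by (simp only: card_cartesian_product) simp
    with k(2) show False by (simp add: power2_eq_square)
  qed
  then obtain i j i' j' where ij: "i \<in> {0..int k}" "j \<in> {0..int k}" "i' \<in> {0..int k}" "j' \<in> {0..int k}"
    and ne: "(i, j) \<noteq> (i', j')" and eq: "(i * b - j * a) mod int p = (i' * b - j' * a) mod int p"
    unfolding inj_on_def F_def by auto
  define g h where "g = i - i'" and "h = j - j'"
  have "\<bar>g\<bar> \<le> \<bar>int k\<bar>" "\<bar>h\<bar> \<le> \<bar>int k\<bar>" using ij by (auto simp: g_def h_def)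
  then have "g ^ 2 \<le> int k ^ 2" "h ^ 2 \<le> int k ^ 2" by (simp_all only: abs_le_square_iff)
  moreover have "int k ^ 2 < int p" using k2 by (metis of_nat_less_iff of_nat_power)
  ultimately have lt: "g ^ 2 + 2 * h ^ 2 < 3 * int p" by linarith
  have "g \<noteq> 0 \<or> h \<noteq> 0" using ne by (auto simp: g_def h_def)
  then have pos: "g ^ 2 + 2 * h ^ 2 > 0"
    by (smt (verit) zero_le_power2 zero_less_power2)
  have "int p dvd g * b - h * a"
    using eq by (simp add: mod_eq_dvd_iff g_def h_def algebra_simps)
  then have "int p dvd (g * b - h * a) * (g * b + h * a) + h ^ 2 * (a ^ 2 + 2 * b ^ 2)"
    by (rule dvd_add[OF dvd_mult2 dvd_mult[OF dvd]])
  also have "\<dots> = b ^ 2 * (g ^ 2 + 2 * h ^ 2)"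
    by (simp add: power2_eq_square algebra_simps)
  finally have "int p dvd g ^ 2 + 2 * h ^ 2"
    using b pint by (auto simp: prime_dvd_mult_iff prime_dvd_power_iff)
  then obtain c where c: "g ^ 2 + 2 * h ^ 2 = int p * c" by blast
  have "c > 0" using pos c p(1) by (metis of_nat_0_le_iff zero_less_mult_pos prime_gt_0_nat of_nat_0_less_iff)
  moreover have "c < 3" using lt c p(1)
    by (metis mult.commute mult_less_cancel_left_pos of_nat_0_less_iff prime_gt_0_nat)
  ultimately have "c = 1 \<or> c = 2" by linarith
  then show thesis
  proof
    assume "c = 1"
    with c that show thesis by simp
  next
    assume "c = 2"
    \<comment> \<open>For \<open>2 * p\<close> the entry \<open>g\<close> is even, and halving the
      equation swaps the roles of the two squares.\<close>
    with c have "g ^ 2 = 2 * (int p - h ^ 2)" by simp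
    then have "even (g ^ 2)" by simp
    then obtain g' where "g = 2 * g'" by (auto elim!: evenE)
    with c \<open>c = 2\<close> have "h ^ 2 + 2 * g' ^ 2 = int p" by (simp add: power_mult_distrib)
    with that show thesis .
  qed
qed

text \<open>Multiplication of \<open>x + y sqrt(-2)\<close> by
  \<open>g + h sqrt(-2)\<close>.\<close>

definition brahmagupta :: "int \<Rightarrow> int \<Rightarrow> int \<times> int \<Rightarrow> int \<times> int" where
  "brahmagupta g h = (\<lambda>(x, y). (g * x - 2 * h * y, g * y + h * x))"

lemma inj_brahmagupta:
  assumes "g ^ 2 + 2 * h ^ 2 \<noteq> 0"
  shows "inj (brahmagupta g h)"
proof (rule injI)
  fix z z' assume eq: "brahmagupta g h z = brahmagupta g h z'"
  obtain x y x' y' where z: "z = (x, y)" "z' = (x', y')" by force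
  \<comment> \<open>Multiplying by the conjugate recovers the norm times the argument.\<close>
  have "(g ^ 2 + 2 * h ^ 2) * x = (g ^ 2 + 2 * h ^ 2) * x'"
    "(g ^ 2 + 2 * h ^ 2) * y = (g ^ 2 + 2 * h ^ 2) * y'"
    using eq unfolding z brahmagupta_def prod.case prod.inject by algebra+
  then show "z = z'" using assms z by simp
qed

lemma brahmagupta_reps:
  assumes "g ^ 2 + 2 * h ^ 2 = p" "z \<in> norm_reps v"
  shows "brahmagupta g h z \<in> norm_reps (p * v)"
proof -
  obtain x y where "z = (x, y)" by force
  then show ?thesis using assms
    by (auto simp: norm_reps_def brahmagupta_def power2_eq_square algebra_simps)
qed

text \<open>Divide by multiplying with the conjugate: the product has coordinates
  \<open>g * a + 2 * h * b\<close> and \<open>g * b - h * a\<close>. If \<open>p\<close> divides the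
  second, the norm equation makes it divide the first, and the quotient by \<open>p\<close> is the
  preimage.\<close>

lemma brahmagupta_surj:
  assumes p: "prime p" and gh: "g ^ 2 + 2 * h ^ 2 = p"
    and ab: "(a, b) \<in> norm_reps (p * v)" and dvd: "p dvd g * b - h * a"
  shows "(a, b) \<in> brahmagupta g h ` norm_reps v"
proof -
  have p0: "p \<noteq> 0" using p by auto
  have ab': "a ^ 2 + 2 * b ^ 2 = p * v" using ab by (simp add: norm_reps_def)
  have norm: "(g * a + 2 * h * b) ^ 2 + 2 * (g * b - h * a) ^ 2 = p * (p * v)"
  proof -
    have "(g * a + 2 * h * b) ^ 2 + 2 * (g * b - h * a) ^ 2 = (g ^ 2 + 2 * h ^ 2) * (a ^ 2 + 2 * b ^ 2)"
      by (simp add: power2_eq_square algebra_simps)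
    then show ?thesis by (simp only: gh ab')
  qed
  obtain y where y: "g * b - h * a = p * y" using dvd by blast
  have "(g * a + 2 * h * b) ^ 2 = p * (p * v - 2 * p * y ^ 2)"
    using norm unfolding y by (simp add: power2_eq_square algebra_simps)
  then have "p dvd g * a + 2 * h * b"
    using p by (metis dvd_triv_left prime_dvd_power)
  then obtain x where x: "g * a + 2 * h * b = p * x" by blast
  have "p * p * (x ^ 2 + 2 * y ^ 2) = p * p * v"
    using norm unfolding x y by (simp add: power2_eq_square algebra_simps)
  then have "(x, y) \<in> norm_reps v"
    using p0 by (simp add: norm_reps_def)
  moreover have "p * a = p * (g * x - 2 * h * y)" "p * b = p * (g * y + h * x)"
    using x y gh by algebra+
  then have "(a, b) = brahmagupta g h (x, y)"
    using p0 by (simp add: brahmagupta_def)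
  ultimately show ?thesis by blast
qed

text \<open>Some representation of \<open>int p * v\<close> exists, so \<open>p\<close> is the norm
  of \<open>g + h sqrt(-2)\<close>. Each representation then comes from one of \<open>v\<close> by
  multiplying with this element or with its conjugate, and never with both.\<close>

lemma card_norm_reps_prime_mult:
  fixes p :: nat
  assumes p: "prime p" "odd p" and v: "\<not> int p dvd v"
    and ne: "norm_reps (int p * v) \<noteq> {}"
  shows "card (norm_reps (int p * v)) = 2 * card (norm_reps v)"
proof -
  have pint: "prime (int p)" using p(1) by simp
  \<comment> \<open>Otherwise \<open>p\<close> divides \<open>a\<close> too, and its square divides
    \<open>int p * v\<close>.\<close>
  have b: "\<not> int p dvd b" if "(a, b) \<in> norm_reps (int p * v)" for a b
  proof
    assume "int p dvd b"
    then obtain c where c: "b = int p * c" by blast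
    have ab: "a ^ 2 + 2 * b ^ 2 = int p * v" using that by (simp add: norm_reps_def)
    then have "a ^ 2 = int p * (v - 2 * c * b)" unfolding c by (simp add: power2_eq_square algebra_simps)
    then have "int p dvd a" using pint by (metis dvd_triv_left prime_dvd_power)
    then obtain d where d: "a = int p * d" by blast
    from ab have "int p * (int p * (d ^ 2 + 2 * c ^ 2)) = int p * v"
      unfolding c d by (simp add: power2_eq_square algebra_simps)
    then have "int p * (d ^ 2 + 2 * c ^ 2) = v" using p(1) by (simp add: prime_gt_0_nat)
    then show False using v by auto
  qed
  from ne obtain a0 b0 where ab0: "(a0, b0) \<in> norm_reps (int p * v)" by auto
  then have "int p dvd a0 ^ 2 + 2 * b0 ^ 2" by (simp add: norm_reps_def)
  then obtain g h :: int where gh: "g ^ 2 + 2 * h ^ 2 = int p"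
    using prime_eq_square_plus_twice_square p b[OF ab0] by blast
  have gh': "g ^ 2 + 2 * (- h) ^ 2 = int p" using gh by simp
  have pne: "int p \<noteq> 0" using p(1) by auto
  have g: "\<not> int p dvd g"
  proof
    assume dvd: "int p dvd g"
    then have "int p ^ 2 dvd g ^ 2" by simp
    then have "g \<noteq> 0 \<Longrightarrow> int p ^ 2 \<le> g ^ 2"
      by (rule zdvd_imp_le) simp
    moreover have "int p < int p ^ 2" using prime_gt_1_nat[OF p(1)] by (simp add: power2_eq_square)
    moreover have "g ^ 2 \<le> int p" using gh by (smt (verit) zero_le_power2)
    ultimately have "g = 0" by linarith
    then have "even (int p)" using gh by (metis add.left_neutral dvd_triv_left zero_power2)
    then show False using p(2) by simp
  qed
  let ?V = "norm_reps v" and ?S = "brahmagupta g h" and ?T = "brahmagupta g (- h)"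
  have union: "norm_reps (int p * v) = ?S ` ?V \<union> ?T ` ?V"
  proof
    show "norm_reps (int p * v) \<subseteq> ?S ` ?V \<union> ?T ` ?V"
    proof
      fix z assume z: "z \<in> norm_reps (int p * v)"
      obtain a b where ab: "z = (a, b)" by force
      \<comment> \<open>The two factors are the divisibility conditions for dividing by the element
        and by its conjugate.\<close>
      have "(g * b - h * a) * (g * b + h * a) = b ^ 2 * (g ^ 2 + 2 * h ^ 2) - h ^ 2 * (a ^ 2 + 2 * b ^ 2)"
        by (simp add: power2_eq_square algebra_simps)
      also have "a ^ 2 + 2 * b ^ 2 = int p * v" using z ab by (simp add: norm_reps_def)
      also have "b ^ 2 * (g ^ 2 + 2 * h ^ 2) - h ^ 2 * (int p * v) = int p * (b ^ 2 - h ^ 2 * v)"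
        unfolding gh by (simp add: algebra_simps)
      finally have "int p dvd g * b - h * a \<or> int p dvd g * b + h * a"
        using pint by (metis dvd_triv_left prime_dvd_mult_iff)
      then show "z \<in> ?S ` ?V \<union> ?T ` ?V"
        using brahmagupta_surj[OF pint gh z[unfolded ab]] brahmagupta_surj[OF pint gh' z[unfolded ab]]
        unfolding ab by auto
    qed
  qed (use brahmagupta_reps gh gh' in auto)
  have disj: "?S ` ?V \<inter> ?T ` ?V = {}"
  proof (rule ccontr)
    assume "?S ` ?V \<inter> ?T ` ?V \<noteq> {}"
    then obtain z w where "z \<in> ?V" "?S z = ?T w" by (auto simp del: split_paired_Ex) metis
    then obtain x y x' y' where "(x, y) \<in> ?V" and eq: "?S (x, y) = ?T (x', y')"
      by (metis surj_pair)
    then have rep: "?S (x, y) \<in> norm_reps (int p * v)" using brahmagupta_reps gh by blast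
    obtain a b where ab: "?S (x, y) = (a, b)" by force
    have "g * x - 2 * h * y = a" "g * y + h * x = b"
      "g * x' + 2 * h * y' = a" "g * y' - h * x' = b"
      using ab eq by (simp_all add: brahmagupta_def)
    note e = this
    \<comment> \<open>A common image would make \<open>p\<close> divide both factors, hence their
      sum \<open>2 * (g * b)\<close>.\<close>
    have "g * b - h * a = int p * y"
      unfolding e(1,2) [symmetric] gh [symmetric] by (simp add: power2_eq_square algebra_simps)
    moreover have "g * b + h * a = int p * y'"
      unfolding e(3,4) [symmetric] gh [symmetric] by (simp add: power2_eq_square algebra_simps)
    ultimately have "2 * (g * b) = int p * (y + y')" by (simp add: algebra_simps)
    then have "int p dvd 2 * (g * b)" by simp
    moreover have "\<not> int p dvd 2"
    proof
      assume "int p dvd 2"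
      then have "p dvd 2" by presburger
      then show False using p by (metis primes_dvd_imp_eq two_is_prime_nat even_numeral dvd_refl)
    qed
    ultimately show False using g b rep ab pint by (auto simp: prime_dvd_mult_iff)
  qed
  have "inj_on ?S ?V" "inj_on ?T ?V"
    using inj_brahmagupta[of g h] inj_brahmagupta[of g "- h"] gh pne
    by (auto intro: inj_on_subset)
  then show ?thesis
    unfolding union using disj by (simp add: card_Un_disjoint finite_norm_reps card_image)
qed

section \<open>The parity of the number of positive representations\<close>

definition positive_norm_reps :: "int \<Rightarrow> (int \<times> int) set" where
  "positive_norm_reps n = {(x, y). x > 0 \<and> y > 0 \<and> x ^ 2 + 2 * y ^ 2 = n}"

text \<open>Oddness of \<open>n\<close> rules out \<open>x = 0\<close> and its not being a square
  rules out \<open>y = 0\<close>, so all four sign choices are distinct.\<close>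

lemma card_norm_reps_signs:
  assumes "\<And>x. x ^ 2 \<noteq> n" "odd n"
  shows "card (norm_reps n) = 4 * card (positive_norm_reps n)"
proof -
  have "bij_betw (\<lambda>((s, t), (x, y)). (s * x, t * y))
      (({1, -1} \<times> {1, -1}) \<times> positive_norm_reps n) (norm_reps n)"
  proof (rule bij_betwI[where g = "\<lambda>(x, y). ((sgn x, sgn y), (\<bar>x\<bar>, \<bar>y\<bar>))"], goal_cases)
    case 1
    show ?case by (auto simp: positive_norm_reps_def norm_reps_def power_mult_distrib)
  next
    case 2
    show ?case
    proof
      fix z assume z: "z \<in> norm_reps n"
      obtain x y where xy: "z = (x, y)" by force
      have n: "x ^ 2 + 2 * y ^ 2 = n" using z xy by (simp add: norm_reps_def)
      then have "x \<noteq> 0" "y \<noteq> 0" using assms(1)[of x] assms(2) by auto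
      then show "(case z of (x, y) \<Rightarrow> ((sgn x, sgn y), (\<bar>x\<bar>, \<bar>y\<bar>)))
          \<in> ({1, -1} \<times> {1, -1}) \<times> positive_norm_reps n"
        using n by (auto simp: xy positive_norm_reps_def sgn_if)
    qed
  next
    case (3 x)
    then show ?case by (auto simp: positive_norm_reps_def)
  next
    case (4 z)
    then show ?case by (cases z) (simp add: sgn_mult_abs)
  qed
  then have "card (norm_reps n) = card (({1, -1::int} \<times> {1, -1::int}) \<times> positive_norm_reps n)"
    by (simp add: bij_betw_same_card)
  then show ?thesis by (simp add: card_cartesian_product)
qed

lemma not_square_of_mod_8_eq_3:
  assumes "n mod 8 = (3::int)"
  shows "x ^ 2 \<noteq> n"
proof -
  have "x mod 8 \<in> {0, 1, 2, 3, 4, 5, 6, 7}" by (simp, presburger)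
  then have "x ^ 2 mod 8 \<noteq> 3" by (auto simp: power_mod [symmetric, of x])
  then show ?thesis using assms by auto
qed

text \<open>The residue forces both roots to be odd: \<open>n\<close> is odd, and an even
  \<open>y\<close> would make it 1 modulo 8.\<close>

lemma card_odd_square_pairs:
  fixes n :: nat
  assumes n: "n mod 8 = 3"
  shows "card {(a, b). a \<in> {m ^ 2 |m::nat. odd m} \<and> b \<in> {2 * m ^ 2 |m. odd m} \<and> a + b = n}
    = card (positive_norm_reps (int n))" (is "card ?A = card ?B")
proof -
  have "bij_betw (\<lambda>(x, y). (nat (x ^ 2), nat (2 * y ^ 2))) ?B ?A"
    unfolding bij_betw_def
  proof (intro conjI inj_onI subset_antisym subsetI, goal_cases)
    case (1 z z')
    then show ?case by (auto simp: positive_norm_reps_def eq_nat_nat_iff power2_eq_iff)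
  next
    case (2 z)
    then obtain x y :: int where xy: "x > 0" "y > 0" "x ^ 2 + 2 * y ^ 2 = int n"
      and z: "z = (nat (x ^ 2), nat (2 * y ^ 2))" by (auto simp: positive_norm_reps_def)
    define x' y' where "x' = nat x" and "y' = nat y"
    have x: "x = int x'" "y = int y'" using xy by (auto simp: x'_def y'_def)
    have "int (x' ^ 2 + 2 * y' ^ 2) = int n" using xy(3) unfolding x by simp
    then have eq: "x' ^ 2 + 2 * y' ^ 2 = n" by (simp only: of_nat_eq_iff)
    have "odd n" using n by presburger
    then have "odd (x' ^ 2)" using eq by presburger
    then have x_odd: "odd x'" by simp
    have "odd y'"
    proof
      assume "even y'"
      then obtain k where "y' = 2 * k" by blast
      then have "n = x' ^ 2 + 8 * k ^ 2" using eq by (simp add: power_mult_distrib)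
      then show False using odd_square_mod_8[OF x_odd] n by simp
    qed
    moreover have "z = (x' ^ 2, 2 * y' ^ 2)"
      unfolding z x by (simp add: nat_mult_distrib nat_power_eq)
    ultimately show ?case using x_odd eq by auto
  next
    case (3 z)
    then obtain c d :: nat where cd: "odd c" "odd d" "z = (c ^ 2, 2 * d ^ 2)" "c ^ 2 + 2 * d ^ 2 = n"
      by auto
    have "(int c, int d) \<in> ?B"
      using cd odd_pos by (auto simp: positive_norm_reps_def)
    moreover have "z = (nat (int c ^ 2), nat (2 * int d ^ 2))"
      unfolding cd(3) by (simp add: nat_mult_distrib nat_power_eq)
    ultimately show ?case by (intro rev_image_eqI[of "(int c, int d)"]) auto
  qed
  then show ?thesis by (simp add: bij_betw_same_card)
qed

text \<open>With \<open>n = p * v\<close> and \<open>v\<close> not a square, four times the positive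
  count for \<open>n\<close> is eight times that for \<open>v\<close>, so the count for
  \<open>n\<close> is even.\<close>

lemma odd_card_odd_square_pairs:
  fixes n p :: nat
  assumes odd: "odd (card {(a, b). a \<in> {m ^ 2 |m::nat. odd m} \<and> b \<in> {2 * m ^ 2 |m. odd m} \<and> a + b = n})"
    (is "odd (card ?A)")
    and p: "prime p" "odd p" "p dvd n" "\<not> p ^ 2 dvd n"
  shows "\<exists>m. n = p * m ^ 2"
proof (rule ccontr)
  assume nsq: "\<nexists>m. n = p * m ^ 2"
  obtain v where v: "n = p * v" using p(3) by blast
  have pv: "\<not> int p dvd int v"
    using p(4) unfolding v by (auto simp: power2_eq_square)
  have "?A \<noteq> {}" using odd by (rule odd_card_imp_not_empty)
  then obtain c d :: nat where cd: "odd c" "odd d" "n = c ^ 2 + 2 * d ^ 2" by auto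
  have n8: "n mod 8 = 3"
  proof -
    have "n = 3 + (c ^ 2 div 8 + 2 * (d ^ 2 div 8)) * 8"
      using odd_square_mod_8 [OF cd(1)] odd_square_mod_8 [OF cd(2)]
        div_mult_mod_eq [of "c ^ 2" 8] div_mult_mod_eq [of "d ^ 2" 8]
      unfolding cd(3) distrib_right by linarith
    then have "n mod 8 = 3 mod 8" by (metis mod_mult_self1)
    then show ?thesis by simp
  qed
  have n_odd: "odd n" using n8 by presburger
  have int_n8: "int n mod 8 = 3" using n8 by presburger
  have "(int c, int d) \<in> norm_reps (int n)"
    using cd(3) by (simp add: norm_reps_def)
  then have "card (norm_reps (int n)) = 2 * card (norm_reps (int v))"
    using card_norm_reps_prime_mult[OF p(1,2) pv] unfolding v by auto
  also have "card (norm_reps (int v)) = 4 * card (positive_norm_reps (int v))"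
  proof (rule card_norm_reps_signs)
    fix x
    show "x ^ 2 \<noteq> int v"
    proof
      assume "x ^ 2 = int v"
      then have "int v = int (nat \<bar>x\<bar> ^ 2)" by simp
      then have "v = nat \<bar>x\<bar> ^ 2" by (simp only: of_nat_eq_iff)
      with v nsq show False by blast
    qed
    show "odd (int v)" using n_odd v by simp
  qed
  also have "card (norm_reps (int n)) = 4 * card (positive_norm_reps (int n))"
    using not_square_of_mod_8_eq_3[OF int_n8] n_odd by (intro card_norm_reps_signs) auto
  finally have "even (card (positive_norm_reps (int n)))" by presburger
  then show False using odd unfolding card_odd_square_pairs[OF n8] by blast
qed

section \<open>Divergence of the sum of the reciprocals of the primes\<close>

text \<open>Write \<open>n = s * m ^ 2\<close> with \<open>s\<close> squarefree: \<open>s\<close> is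
  the product of a subset of \<open>Q\<close>, and \<open>m\<close> is at most
  \<open>L\<close>.\<close>

lemma card_smooth_le:
  fixes Q :: "nat set"
  assumes Q: "finite Q"
  shows "card {n \<in> {1..L ^ 2}. \<forall>q. prime q \<and> q dvd n \<longrightarrow> q \<in> Q} \<le> 2 ^ card Q * L"
proof -
  let ?S = "{n \<in> {1..L ^ 2}. \<forall>q. prime q \<and> q dvd n \<longrightarrow> q \<in> Q}"
  have "?S \<subseteq> (\<lambda>(T, m). \<Prod>T * m ^ 2) ` (Pow Q \<times> {1..L})"
  proof
    fix n assume n: "n \<in> ?S"
    define s m where "s = squarefree_part n" and "m = square_part n"
    have nsm: "n = s * m ^ 2" unfolding s_def m_def by (rule squarefree_decompose)
    have n0: "n > 0" using n by auto
    then have s0: "s > 0" and m0: "m > 0" using nsm by (auto intro: gr0I)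
    have "(\<Prod>p\<in>prime_factors s. p ^ multiplicity p s) = s"
      using s0 by (metis prime_factorization_nat)
    moreover have "multiplicity p s = 1" if "p \<in> prime_factors s" for p
    proof -
      have "squarefree s" by (simp add: s_def)
      then show ?thesis using that s0 squarefree_factorial_semiring'[of s] by auto
    qed
    ultimately have "\<Prod>(prime_factors s) = s" by simp
    moreover have "prime_factors s \<in> Pow Q"
      using n nsm by (auto simp: in_prime_factors_iff)
    moreover have "m ^ 2 \<le> n" using nsm s0 by simp
    moreover have "n \<le> L ^ 2" using n by simp
    then have "m ^ 2 \<le> L ^ 2" using \<open>m ^ 2 \<le> n\<close> by (meson order_trans)
    then have "m \<in> {1..L}" using m0 by simp
    ultimately show "n \<in> (\<lambda>(T, m). \<Prod>T * m ^ 2) ` (Pow Q \<times> {1..L})"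
      using nsm by (intro rev_image_eqI[of "(prime_factors s, m)"]) auto
  qed
  then have "card ?S \<le> card (Pow Q \<times> {1..L})"
    using Q by (intro surj_card_le) auto
  then show ?thesis using Q by (simp add: card_Pow card_cartesian_product)
qed

lemma card_multiples_le: "real (card {n \<in> {1..N}. p dvd n}) \<le> real N / real p"
proof (cases "p = 0")
  case False
  have "{n \<in> {1..N}. p dvd n} \<subseteq> (\<lambda>k. p * k) ` {1..N div p}"
  proof
    fix n assume n: "n \<in> {n \<in> {1..N}. p dvd n}"
    then obtain k where k: "n = p * k" by auto
    then have "k \<le> N div p" "k \<ge> 1" using n False by (auto simp: less_eq_div_iff_mult_less_eq mult.commute intro: gr0I)
    then show "n \<in> (\<lambda>k. p * k) ` {1..N div p}" using k by auto
  qed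
  then have "card {n \<in> {1..N}. p dvd n} \<le> card {1..N div p}"
    by (intro surj_card_le) auto
  then have "real (card {n \<in> {1..N}. p dvd n}) \<le> real (N div p)" by simp
  also have "\<dots> \<le> real N / real p" by (rule of_nat_div_le_of_nat)
  finally show ?thesis .
qed auto

lemma sum_reciprocal_odd_primes_tail:
  fixes Q :: "nat set"
  assumes Q: "finite Q"
  obtains P where "finite P" "P \<inter> Q = {}" "\<And>p. p \<in> P \<Longrightarrow> prime p \<and> odd p"
    "(\<Sum>p\<in>P. 1 / real p) \<ge> 1 / 4"
proof -
  \<comment> \<open>Excluding 2 as well makes all primes of \<open>P\<close> odd.\<close>
  define Q' where "Q' = insert 2 Q"
  \<comment> \<open>With this \<open>L\<close> the bound on smooth numbers is exactly
    \<open>N / 2\<close>, so the multiples of primes in \<open>P\<close> must cover the other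
    half.\<close>
  define L where "L = (2::nat) ^ (card Q' + 1)"
  define N where "N = L ^ 2"
  \<comment> \<open>Erdos: an \<open>n \<le> N\<close> is divisible by some prime outside \<open>Q'\<close> or is one of few \<open>Q'\<close>-smooth numbers.\<close>
  define P where "P = {p \<in> {1..N}. prime p \<and> p \<notin> Q'}"
  have finQ': "finite Q'" and finP: "finite P" using Q by (auto simp: Q'_def P_def)
  let ?S = "{n \<in> {1..L ^ 2}. \<forall>q. prime q \<and> q dvd n \<longrightarrow> q \<in> Q'}"
  have "{1..N} \<subseteq> ?S \<union> (\<Union>p\<in>P. {n \<in> {1..N}. p dvd n})"
  proof
    fix n assume n: "n \<in> {1..N}"
    show "n \<in> ?S \<union> (\<Union>p\<in>P. {n \<in> {1..N}. p dvd n})"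
    proof (cases "\<forall>q. prime q \<and> q dvd n \<longrightarrow> q \<in> Q'")
      case False
      then obtain q where q: "prime q" "q dvd n" "q \<notin> Q'" by blast
      then have "q \<le> n" "q \<ge> 1" using n by (auto intro: dvd_imp_le prime_ge_1_nat)
      then have "q \<in> P" using q n by (auto simp: P_def)
      then show ?thesis using q n by auto
    qed (use n in \<open>auto simp: N_def\<close>)
  qed
  then have "card {1..N} \<le> card (?S \<union> (\<Union>p\<in>P. {n \<in> {1..N}. p dvd n}))"
    using finP by (intro card_mono) auto
  also have "\<dots> \<le> card ?S + card (\<Union>p\<in>P. {n \<in> {1..N}. p dvd n})"
    by (rule card_Un_le)
  also have "\<dots> \<le> 2 ^ card Q' * L + (\<Sum>p\<in>P. card {n \<in> {1..N}. p dvd n})"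
    by (intro add_mono card_smooth_le finQ' card_UN_le finP)
  finally have "real N \<le> real (2 ^ card Q' * L + (\<Sum>p\<in>P. card {n \<in> {1..N}. p dvd n}))"
    by (simp only: card_atLeastAtMost of_nat_le_iff)
  also have "\<dots> = real (2 ^ card Q' * L) + (\<Sum>p\<in>P. real (card {n \<in> {1..N}. p dvd n}))"
    by simp
  also have "\<dots> \<le> real (2 ^ card Q' * L) + (\<Sum>p\<in>P. real N / real p)"
    by (intro add_left_mono sum_mono card_multiples_le)
  also have "2 ^ card Q' * L * 2 = N" by (simp add: N_def L_def power2_eq_square)
  then have "real (2 ^ card Q' * L) = real N / 2" by (metis nonzero_mult_div_cancel_right of_nat_mult of_nat_numeral zero_neq_numeral)
  also have "(\<Sum>p\<in>P. real N / real p) = real N * (\<Sum>p\<in>P. 1 / real p)"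
    by (simp add: sum_distrib_left)
  finally have "real N * (1 / 2) \<le> real N * (\<Sum>p\<in>P. 1 / real p)" by simp
  moreover have "real N > 0" by (simp add: N_def L_def)
  ultimately have "1 / 2 \<le> (\<Sum>p\<in>P. 1 / real p)" by (simp only: mult_le_cancel_left_pos)
  then have "1 / 4 \<le> (\<Sum>p\<in>P. 1 / real p)" by simp
  moreover have "prime p \<and> odd p" if "p \<in> P" for p
    using that by (auto simp: P_def Q'_def dest: primes_dvd_imp_eq[OF two_is_prime_nat])
  moreover have "P \<inter> Q = {}" by (auto simp: P_def Q'_def)
  ultimately show thesis using that finP by blast
qed

text \<open>Each step adds a set of new primes contributing at least 1/4.\<close>

lemma sum_reciprocal_odd_primes_unbounded:
  obtains P :: "nat set" where "finite P" "\<And>p. p \<in> P \<Longrightarrow> prime p \<and> odd p"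
    "(\<Sum>p\<in>P. 1 / real p) \<ge> C"
proof -
  have *: "\<exists>P::nat set. finite P \<and> (\<forall>p\<in>P. prime p \<and> odd p) \<and> real k / 4 \<le> (\<Sum>p\<in>P. 1 / real p)" for k :: nat
  proof (induction k)
    case 0
    show ?case by (intro exI[of _ "{}"]) simp
  next
    case (Suc k)
    then obtain P :: "nat set" where P: "finite P" "\<forall>p\<in>P. prime p \<and> odd p" "real k / 4 \<le> (\<Sum>p\<in>P. 1 / real p)"
      by blast
    obtain P' where P': "finite P'" "P' \<inter> P = {}" "\<And>p. p \<in> P' \<Longrightarrow> prime p \<and> odd p"
      "(\<Sum>p\<in>P'. 1 / real p) \<ge> 1 / 4"
      using sum_reciprocal_odd_primes_tail[OF P(1)] by metis
    have "(\<Sum>p\<in>P' \<union> P. 1 / real p) = (\<Sum>p\<in>P'. 1 / real p) + (\<Sum>p\<in>P. 1 / real p)"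
      by (intro sum.union_disjoint P(1) P'(1,2))
    then have "real (Suc k) / 4 \<le> (\<Sum>p\<in>P' \<union> P. 1 / real p)"
      using P(3) P'(4) by (simp add: add_divide_distrib)
    then show ?case using P P' by (intro exI[of _ "P' \<union> P"]) auto
  qed
  obtain k :: nat where "C * 4 \<le> real k" using real_arch_simple by blast
  then have "C \<le> real k / 4" by simp
  with *[of k] that show thesis by (meson order_trans)
qed

section \<open>Integers with an exact prime divisor\<close>

definition exactly_divides :: "nat \<Rightarrow> nat \<Rightarrow> bool" where
  "exactly_divides p n \<longleftrightarrow> p dvd n \<and> \<not> p ^ 2 dvd n"

lemma exactly_divides_mod:
  assumes "p ^ 2 dvd M"
  shows "exactly_divides p (n mod M) \<longleftrightarrow> exactly_divides p n"
proof -
  have "p dvd M" using assms by (metis dvd_trans dvd_triv_left power2_eq_square)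
  then show ?thesis using assms by (simp add: exactly_divides_def dvd_mod_iff)
qed

lemma exactly_divides_mod_prod:
  assumes "finite P" "p \<in> P"
  shows "exactly_divides p (n mod (\<Prod>p\<in>P. p ^ 2)) \<longleftrightarrow> exactly_divides p n"
  using assms by (intro exactly_divides_mod dvd_prodI[of P p "\<lambda>p. p ^ 2"])

text \<open>The excluded residues are \<open>p * k\<close> with
  \<open>1 \<le> k < p\<close>.\<close>

lemma card_not_exactly_divides:
  assumes p: "p > 1"
  shows "card {n \<in> {..<p ^ 2}. \<not> exactly_divides p n} = p ^ 2 - (p - 1)"
proof -
  have "{n \<in> {..<p ^ 2}. exactly_divides p n} = (\<lambda>k. p * k) ` {1..<p}"
  proof (intro subset_antisym subsetI)
    fix n assume "n \<in> {n \<in> {..<p ^ 2}. exactly_divides p n}"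
    then have n: "n < p ^ 2" "p dvd n" "\<not> p ^ 2 dvd n" by (auto simp: exactly_divides_def)
    then obtain k where k: "n = p * k" by blast
    with n p have "k < p" by (simp add: power2_eq_square)
    moreover have "k \<noteq> 0" by (rule notI) (use n(3) k in simp)
    ultimately show "n \<in> (\<lambda>k. p * k) ` {1..<p}" using k by auto
  next
    fix n assume "n \<in> (\<lambda>k. p * k) ` {1..<p}"
    then obtain k where k: "n = p * k" "1 \<le> k" "k < p" by auto
    then have "\<not> p dvd k" by (auto dest: dvd_imp_le)
    then show "n \<in> {n \<in> {..<p ^ 2}. exactly_divides p n}"
      using k p by (simp add: exactly_divides_def power2_eq_square)
  qed
  then have "card {n \<in> {..<p ^ 2}. exactly_divides p n} = p - 1"
    using p by (simp add: card_image inj_on_def)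
  moreover have "{n \<in> {..<p ^ 2}. \<not> exactly_divides p n} = {..<p ^ 2} - {n \<in> {..<p ^ 2}. exactly_divides p n}"
    by auto
  moreover have "card ({..<p ^ 2} - {n \<in> {..<p ^ 2}. exactly_divides p n})
      = card {..<p ^ 2} - card {n \<in> {..<p ^ 2}. exactly_divides p n}"
    by (rule card_Diff_subset) auto
  ultimately show ?thesis by simp
qed

lemma card_coprime_residue_conditions:
  fixes a b :: nat
  assumes "coprime a b" "a > 0" "b > 0"
  shows "card {n \<in> {..<a * b}. A (n mod a) \<and> B (n mod b)}
    = card {n \<in> {..<a}. A n} * card {n \<in> {..<b}. B n}"
proof -
  have "bij_betw (\<lambda>n. (n mod a, n mod b)) {n \<in> {..<a * b}. A (n mod a) \<and> B (n mod b)}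
    ({n \<in> {..<a}. A n} \<times> {n \<in> {..<b}. B n})"
    unfolding bij_betw_def
  proof (intro conjI inj_onI subset_antisym subsetI, goal_cases)
    case (1 m n)
    then have "[m = n] (mod a)" "[m = n] (mod b)" by (auto simp: Cong.cong_def)
    then have "[m = n] (mod a * b)"
      using assms(1) by (rule coprime_cong_mult_nat)
    with 1 show ?case by (simp add: Cong.cong_def)
  next
    case (2 z)
    then show ?case using assms by auto
  next
    case (3 z)
    then obtain i j where z: "z = (i, j)" "i < a" "j < b" "A i" "B j" by auto
    obtain n where "n < a * b" "[n = i] (mod a)" "[n = j] (mod b)"
      using binary_chinese_remainder_unique_nat[OF assms(1), of i j] assms(2,3) by auto
    then show ?case using z by (intro rev_image_eqI[of n]) (auto simp: Cong.cong_def)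
  qed
  then show ?thesis by (simp add: bij_betw_same_card card_cartesian_product)
qed

text \<open>Each condition depends only on the residue modulo \<open>p ^ 2\<close>, so the Chinese
  remainder theorem makes the counts multiply.\<close>

lemma card_no_exact_divisor:
  fixes P :: "nat set"
  assumes "finite P" "\<And>p. p \<in> P \<Longrightarrow> prime p"
  shows "card {n \<in> {..<\<Prod>p\<in>P. p ^ 2}. \<forall>p\<in>P. \<not> exactly_divides p n} = (\<Prod>p\<in>P. p ^ 2 - (p - 1))"
  using assms
proof (induction P rule: finite_induct)
  case empty
  have "{n \<in> {..<1::nat}. True} = {0}" by auto
  then show ?case by simp
next
  case (insert q P)
  let ?M = "\<Prod>p\<in>P. p ^ 2"
  have q: "prime q" using insert.prems by auto
  have "coprime (q ^ 2) ?M"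
    using insert by (intro prod_coprime_right) (auto intro!: primes_coprime)
  moreover have "q ^ 2 > 0" "?M > 0"
    using insert by (auto intro!: prod_pos simp: prime_gt_0_nat)
  ultimately have "card {n \<in> {..<q ^ 2 * ?M}. \<not> exactly_divides q (n mod q ^ 2) \<and>
        (\<forall>p\<in>P. \<not> exactly_divides p (n mod ?M))}
    = card {n \<in> {..<q ^ 2}. \<not> exactly_divides q n} * card {n \<in> {..<?M}. \<forall>p\<in>P. \<not> exactly_divides p n}"
    by (rule card_coprime_residue_conditions)
  also have "{n \<in> {..<q ^ 2 * ?M}. \<not> exactly_divides q (n mod q ^ 2) \<and>
        (\<forall>p\<in>P. \<not> exactly_divides p (n mod ?M))}
    = {n \<in> {..<\<Prod>p\<in>insert q P. p ^ 2}. \<forall>p\<in>insert q P. \<not> exactly_divides p n}"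
    using insert.hyps by (auto simp: exactly_divides_mod exactly_divides_mod_prod)
  finally show ?case
    unfolding card_not_exactly_divides [OF prime_gt_1_nat [OF q]] using insert by simp
qed

text \<open>Quotient and remainder modulo \<open>M\<close> determine \<open>n\<close>; the extra 1
  covers the last, possibly incomplete, block.\<close>

lemma card_periodic_le:
  fixes M N :: nat
  assumes M: "M > 0" and per: "\<And>n. A (n mod M) \<longleftrightarrow> A n"
  shows "card {n \<in> {0..N}. A n} \<le> (N div M + 1) * card {n \<in> {..<M}. A n}"
proof -
  have "inj_on (\<lambda>n. (n div M, n mod M)) {n \<in> {0..N}. A n}"
    by (rule inj_onI) (metis div_mult_mod_eq prod.inject)
  moreover have "(\<lambda>n. (n div M, n mod M)) ` {n \<in> {0..N}. A n} \<subseteq> {0..N div M} \<times> {n \<in> {..<M}. A n}"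
    using M per by (auto intro: div_le_mono)
  ultimately have "card {n \<in> {0..N}. A n} \<le> card ({0..N div M} \<times> {n \<in> {..<M}. A n})"
    by (intro card_inj_on_le) auto
  then show ?thesis by (simp add: card_cartesian_product)
qed

text \<open>The ratio is \<open>1 - 1/p + 1/p^2\<close>, at most \<open>1 - 1/(2p)\<close> as
  \<open>p \<ge> 2\<close>. The exponential form turns the product over primes into a sum of
  reciprocals.\<close>

lemma sieve_factor_le:
  assumes "prime p"
  shows "real (p ^ 2 - (p - 1)) / real (p ^ 2) \<le> exp (- (1 / 2) * (1 / real p))"
proof -
  have p: "real p \<ge> 2" using prime_ge_2_nat[OF assms] by simp
  have "p - 1 \<le> p ^ 2" by (metis diff_le_self le_trans power2_eq_square le_square)
  then have "real (p ^ 2 - (p - 1)) = real p ^ 2 - (real p - 1)"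
    using prime_ge_1_nat[OF assms] by (simp add: of_nat_diff)
  then have "real (p ^ 2 - (p - 1)) / real (p ^ 2) = 1 - 1 / real p + 1 / real p * (1 / real p)"
    using p by (simp add: field_simps power2_eq_square)
  also have "1 / real p * (1 / real p) \<le> 1 / 2 * (1 / real p)"
    using p by (intro mult_right_mono) (auto simp: field_simps)
  then have "1 - 1 / real p + 1 / real p * (1 / real p) \<le> 1 + (- (1 / 2) * (1 / real p))"
    by simp
  also have "\<dots> \<le> exp (- (1 / 2) * (1 / real p))"
    by (rule exp_ge_add_one_self)
  finally show ?thesis .
qed

section \<open>Sets of density zero\<close>

definition density_zero :: "nat set \<Rightarrow> bool" where
  "density_zero X \<longleftrightarrow> (\<forall>\<epsilon>>0. \<forall>\<^sub>F N in sequentially. real (card (X \<inter> {0..N})) \<le> \<epsilon> * (real N + 1))"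

lemma card_square_multiples_le:
  assumes "p > (0::nat)"
  shows "card {n \<in> {0..N}. \<exists>m. n = p * m ^ 2} \<le> floor_sqrt N + 1"
proof -
  have "{n \<in> {0..N}. \<exists>m. n = p * m ^ 2} \<subseteq> (\<lambda>m. p * m ^ 2) ` {0..floor_sqrt N}"
  proof
    fix n assume n: "n \<in> {n \<in> {0..N}. \<exists>m. n = p * m ^ 2}"
    then obtain m where m: "n = p * m ^ 2" by auto
    then have "m ^ 2 \<le> n" using assms by simp
    also have "n \<le> N" using n by simp
    finally have "m \<le> floor_sqrt N" by (rule le_floor_sqrtI)
    with m show "n \<in> (\<lambda>m. p * m ^ 2) ` {0..floor_sqrt N}" by auto
  qed
  then have "card {n \<in> {0..N}. \<exists>m. n = p * m ^ 2} \<le> card {0..floor_sqrt N}"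
    by (intro surj_card_le) auto
  then show ?thesis by simp
qed

lemma eventually_sqrt_le_linear:
  assumes "\<epsilon> > 0"
  shows "\<forall>\<^sub>F N in sequentially. a + b * (real (floor_sqrt N) + 1) \<le> \<epsilon> * (real N + 1)"
proof -
  have "(\<lambda>N. \<bar>a\<bar> * (1 / (real N + 1)) + \<bar>b\<bar> * ((sqrt (real N) + 1) / (real N + 1))) \<longlonglongrightarrow> \<bar>a\<bar> * 0 + \<bar>b\<bar> * 0"
    by (intro tendsto_intros) real_asymp+
  then have "\<forall>\<^sub>F N in sequentially.
      \<bar>a\<bar> * (1 / (real N + 1)) + \<bar>b\<bar> * ((sqrt (real N) + 1) / (real N + 1)) < \<epsilon>"
    using assms by (intro order_tendstoD(2)) auto
  then show ?thesis
  proof eventually_elim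
    case (elim N)
    have "real (floor_sqrt N) \<le> sqrt (real N)"
      by (intro real_le_rsqrt) (metis floor_sqrt_power2_le of_nat_le_iff of_nat_power)
    then have "a + b * (real (floor_sqrt N) + 1) \<le> \<bar>a\<bar> + \<bar>b\<bar> * (sqrt (real N) + 1)"
      by (intro add_mono mult_mono) auto
    also have "\<dots> = (\<bar>a\<bar> * (1 / (real N + 1)) + \<bar>b\<bar> * ((sqrt (real N) + 1) / (real N + 1))) * (real N + 1)"
      by (simp add: distrib_right)
    also have "\<dots> \<le> \<epsilon> * (real N + 1)"
      using elim by (intro mult_right_mono) auto
    finally show ?case .
  qed
qed

text \<open>For a finite set \<open>P\<close> of odd primes, an element of \<open>X\<close> either
  has no exact divisor in \<open>P\<close>, a periodic condition of small density, or lies in one of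
  finitely many sets of size about the square root of \<open>N\<close>.\<close>

lemma density_zero_exact_prime_times_square:
  assumes X: "\<And>n p. n \<in> X \<Longrightarrow> prime p \<Longrightarrow> odd p \<Longrightarrow> exactly_divides p n \<Longrightarrow> \<exists>m. n = p * m ^ 2"
  shows "density_zero X"
  unfolding density_zero_def
proof (intro allI impI)
  fix \<epsilon> :: real assume eps: "\<epsilon> > 0"
  \<comment> \<open>This bound makes \<open>exp\<close> of minus half the sum at most
    \<open>\<epsilon> / 2\<close>.\<close>
  obtain P :: "nat set" where P: "finite P" "\<And>p. p \<in> P \<Longrightarrow> prime p \<and> odd p"
    "(\<Sum>p\<in>P. 1 / real p) \<ge> - 2 * ln (\<epsilon> / 2)"
    using sum_reciprocal_odd_primes_unbounded by metis
  define M where "M = (\<Prod>p\<in>P. p ^ 2)"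
  define A where "A n \<longleftrightarrow> (\<forall>p\<in>P. \<not> exactly_divides p n)" for n
  define c where "c = card {n \<in> {..<M}. A n}"
  have M: "M > 0" unfolding M_def using P by (auto intro!: prod_pos simp: prime_gt_0_nat)
  have per: "A (n mod M) \<longleftrightarrow> A n" for n
    unfolding A_def M_def using P(1) by (auto simp: exactly_divides_mod exactly_divides_mod_prod)
  have "real c / real M = (\<Prod>p\<in>P. real (p ^ 2 - (p - 1)) / real (p ^ 2))"
    unfolding c_def A_def M_def using P
    by (subst card_no_exact_divisor) (auto simp: prod_dividef)
  also have "\<dots> \<le> (\<Prod>p\<in>P. exp (- (1 / 2) * (1 / real p)))"
    using P by (intro prod_mono conjI sieve_factor_le) auto
  also have "\<dots> = exp (- (1 / 2) * (\<Sum>p\<in>P. 1 / real p))"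
    using P(1) by (simp add: exp_sum sum_distrib_left)
  also have "\<dots> \<le> exp (ln (\<epsilon> / 2))"
    using P(3) by simp
  also have "\<dots> = \<epsilon> / 2" using eps by simp
  finally have ratio: "real c / real M \<le> \<epsilon> / 2" .
  have "\<forall>\<^sub>F N in sequentially. real c + real (card P) * (real (floor_sqrt N) + 1) \<le> \<epsilon> / 2 * (real N + 1)"
    using eps by (intro eventually_sqrt_le_linear) simp
  then show "\<forall>\<^sub>F N in sequentially. real (card (X \<inter> {0..N})) \<le> \<epsilon> * (real N + 1)"
  proof eventually_elim
    case (elim N)
    have "X \<inter> {0..N} \<subseteq> {n \<in> {0..N}. A n} \<union> (\<Union>p\<in>P. {n \<in> {0..N}. \<exists>m. n = p * m ^ 2})"
      using X P(2) by (auto simp: A_def)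
    then have "card (X \<inter> {0..N}) \<le> card ({n \<in> {0..N}. A n} \<union> (\<Union>p\<in>P. {n \<in> {0..N}. \<exists>m. n = p * m ^ 2}))"
      using P(1) by (intro card_mono) auto
    also have "\<dots> \<le> card {n \<in> {0..N}. A n} + card (\<Union>p\<in>P. {n \<in> {0..N}. \<exists>m. n = p * m ^ 2})"
      by (rule card_Un_le)
    also have "\<dots> \<le> (N div M + 1) * c + (\<Sum>p\<in>P. card {n \<in> {0..N}. \<exists>m. n = p * m ^ 2})"
      unfolding c_def by (intro add_mono card_periodic_le M per card_UN_le P(1))
    also have "\<dots> \<le> (N div M + 1) * c + (\<Sum>p\<in>P. floor_sqrt N + 1)"
      using P(2) by (intro add_left_mono sum_mono card_square_multiples_le) (auto simp: prime_gt_0_nat)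
    finally have "real (card (X \<inter> {0..N})) \<le> real ((N div M + 1) * c + (\<Sum>p\<in>P. floor_sqrt N + 1))"
      by (simp only: of_nat_le_iff)
    also have "\<dots> = real (N div M) * real c + (real c + real (card P) * (real (floor_sqrt N) + 1))"
      by (simp add: algebra_simps)
    also have "real (N div M) * real c \<le> real N / real M * real c"
      by (intro mult_right_mono of_nat_div_le_of_nat) simp
    also have "\<dots> = real c / real M * real N" by simp
    also have "\<dots> \<le> \<epsilon> / 2 * (real N + 1)"
      using ratio eps by (intro mult_mono) auto
    also have "\<epsilon> / 2 * (real N + 1) + (real c + real (card P) * (real (floor_sqrt N) + 1))
        \<le> \<epsilon> / 2 * (real N + 1) + \<epsilon> / 2 * (real N + 1)"
      using elim by (rule add_left_mono)
    finally show ?case by (simp add: field_simps)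
  qed
qed

section \<open>The density of the reciprocal\<close>

lemma density_zero_psi_cube: "density_zero {n. (psi ^ 3) $ n \<noteq> 0}"
proof (rule density_zero_exact_prime_times_square)
  fix n p :: nat
  assume n: "n \<in> {n. (psi ^ 3) $ n \<noteq> 0}" and p: "prime p" "odd p" "exactly_divides p n"
  have "psi ^ 3 = psi * psi ^ 2" by (simp add: power3_eq_cube power2_eq_square)
  then have "(psi ^ 3) $ n = of_nat (card
      {(a, b). a \<in> {m ^ 2 |m::nat. odd m} \<and> b \<in> {2 * m ^ 2 |m. odd m} \<and> a + b = n})"
    (is "_ = of_nat ?c")
    unfolding psi_square by (simp only: psi_def gen_fps_mult_nth)
  with n have "(of_nat ?c :: bit) \<noteq> 0" by simp
  then have "odd ?c" by (auto elim!: evenE)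
  then show "\<exists>m. n = p * m ^ 2"
    by (rule odd_card_odd_square_pairs) (use p in \<open>auto simp: exactly_divides_def\<close>)
qed

text \<open>Outside these sets the coefficients of \<open>1\<close>, \<open>psi\<close> and
  \<open>psi ^ 3\<close> vanish, leaving the remainder alone. The form \<open>1 * m ^ 2\<close> fits
  \<open>card_square_multiples_le\<close>.\<close>

lemma reciprocal_set_odd_sigma_set_subset:
  "reciprocal_set odd_sigma_set \<subseteq>
    {0} \<union> {n. \<exists>m. n = 1 * m ^ 2} \<union> {n. (psi ^ 3) $ n \<noteq> 0} \<union> {n. n mod 16 = 7}"
proof
  fix n assume "n \<in> reciprocal_set odd_sigma_set"
  then have R: "reciprocal_odd_sigma $ n = 1" by (simp add: reciprocal_odd_sigma_def)
  show "n \<in> {0} \<union> {n. \<exists>m. n = 1 * m ^ 2} \<union> {n. (psi ^ 3) $ n \<noteq> 0} \<union> {n. n mod 16 = 7}"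
  proof (rule ccontr)
    assume "\<not> ?thesis"
    then have n: "n \<noteq> 0" "\<nexists>m. n = m ^ 2" "(psi ^ 3) $ n = 0" "n mod 16 \<noteq> 7" by simp_all
    from n(2) have "psi $ n = 0" by (auto simp: psi_def)
    with n R have "(reciprocal_odd_sigma + 1 + psi + psi ^ 3) $ n = 1" by simp
    then show False using reciprocal_remainder_support n(4) by fastforce
  qed
qed

lemma eventually_rel_density_le:
  assumes "\<epsilon> > 0"
  shows "\<forall>\<^sub>F N in sequentially. rel_density (reciprocal_set odd_sigma_set) N \<le> 1 / 16 + \<epsilon>"
proof -
  let ?X = "{n. (psi ^ 3) $ n \<noteq> 0}"
  have "\<forall>\<^sub>F N in sequentially. real (card (?X \<inter> {0..N})) \<le> \<epsilon> / 2 * (real N + 1)"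
    using density_zero_psi_cube [unfolded density_zero_def, rule_format, of "\<epsilon> / 2"] assms
    by (simp only: half_gt_zero)
  \<comment> \<open>The constant 2 collects the element 0 and the extra block of the residue class 7
    modulo 16.\<close>
  moreover have "\<forall>\<^sub>F N in sequentially. 2 + 1 * (real (floor_sqrt N) + 1) \<le> \<epsilon> / 2 * (real N + 1)"
    using assms by (intro eventually_sqrt_le_linear) simp
  ultimately show ?thesis
  proof eventually_elim
    case (elim N)
    let ?A = "{n \<in> {0..N}. n mod 16 = 7}" and ?B = "{n \<in> {0..N}. \<exists>m. n = 1 * m ^ 2}"
    have "reciprocal_set odd_sigma_set \<inter> {0..N} \<subseteq> {0} \<union> ?B \<union> (?X \<inter> {0..N}) \<union> ?A"
      using reciprocal_set_odd_sigma_set_subset by blast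
    then have "card (reciprocal_set odd_sigma_set \<inter> {0..N}) \<le> card ({0} \<union> ?B \<union> (?X \<inter> {0..N}) \<union> ?A)"
      by (intro card_mono) auto
    also have "\<dots> \<le> card {0::nat} + card ?B + card (?X \<inter> {0..N}) + card ?A"
      by (meson card_Un_le add_le_mono1 order_trans)
    also have "\<dots> \<le> 1 + (floor_sqrt N + 1) + card (?X \<inter> {0..N}) + (N div 16 + 1)"
    proof -
      have "card ?A \<le> (N div 16 + 1) * card {n \<in> {..<16::nat}. n mod 16 = 7}"
        by (rule card_periodic_le) simp_all
      also have "{n \<in> {..<16::nat}. n mod 16 = 7} = {7}" by auto
      finally have "card ?A \<le> N div 16 + 1" by simp
      moreover have "card ?B \<le> floor_sqrt N + 1" by (rule card_square_multiples_le) simp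
      ultimately show ?thesis by simp
    qed
    finally have "real (card (reciprocal_set odd_sigma_set \<inter> {0..N}))
        \<le> real (1 + (floor_sqrt N + 1) + card (?X \<inter> {0..N}) + (N div 16 + 1))"
      by (simp only: of_nat_le_iff)
    also have "\<dots> = 2 + 1 * (real (floor_sqrt N) + 1) + real (card (?X \<inter> {0..N})) + real (N div 16)"
      by simp
    also have "\<dots> \<le> \<epsilon> / 2 * (real N + 1) + \<epsilon> / 2 * (real N + 1) + real N / 16"
      using elim of_nat_div_le_of_nat [of N 16, where 'a = real] by (intro add_mono) simp_all
    also have "\<dots> \<le> (1 / 16 + \<epsilon>) * (real N + 1)"
      by (simp add: algebra_simps)
    finally show ?case
      by (simp add: rel_density_def divide_le_eq)
  qed
qed

theorem corollary18:
  shows "0 \<le> lower_density (reciprocal_set odd_sigma_set) \<and>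
         upper_density (reciprocal_set odd_sigma_set) \<le> 1 / 16 \<and>
         (convergent (rel_density (reciprocal_set odd_sigma_set)) \<longrightarrow>
            0 \<le> natural_density (reciprocal_set odd_sigma_set) \<and>
            natural_density (reciprocal_set odd_sigma_set) \<le> 1 / 16)"
proof (intro conjI impI)
  let ?d = "rel_density (reciprocal_set odd_sigma_set)"
  have nonneg: "0 \<le> ?d N" for N
    by (simp add: rel_density_def)
  show "0 \<le> lower_density (reciprocal_set odd_sigma_set)"
    unfolding lower_density_def by (rule Liminf_bounded) (simp add: nonneg)
  have "limsup (\<lambda>N. ereal (?d N)) \<le> ereal (1 / 16)"
  proof (rule ereal_le_epsilon2)
    fix \<epsilon> :: real assume "\<epsilon> > 0"
    from eventually_rel_density_le [OF this]
    have "limsup (\<lambda>N. ereal (?d N)) \<le> ereal (1 / 16 + \<epsilon>)"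
      by (intro Limsup_bounded) simp
    then show "limsup (\<lambda>N. ereal (?d N)) \<le> ereal (1 / 16) + ereal \<epsilon>"
      by simp
  qed
  also have "ereal (1 / 16) = 1 / 16"
    by (simp add: divide_ereal_def one_ereal_def)
  finally show "upper_density (reciprocal_set odd_sigma_set) \<le> 1 / 16"
    unfolding upper_density_def .
  assume "convergent ?d"
  \<comment> \<open>Convergence makes \<open>lim\<close> the actual limit, so eventual bounds carry
    over to it.\<close>
  then have lim: "?d \<longlonglongrightarrow> natural_density (reciprocal_set odd_sigma_set)"
    by (simp add: natural_density_def convergent_LIMSEQ_iff)
  then show "0 \<le> natural_density (reciprocal_set odd_sigma_set)"
    by (rule LIMSEQ_le_const) (use nonneg in blast)
  show "natural_density (reciprocal_set odd_sigma_set) \<le> 1 / 16"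
  proof (rule field_le_epsilon)
    fix \<epsilon> :: real assume "\<epsilon> > 0"
    then show "natural_density (reciprocal_set odd_sigma_set) \<le> 1 / 16 + \<epsilon>"
      by (intro tendsto_upperbound [OF lim] eventually_rel_density_le) simp_all
  qed
qed

end
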